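(* Suppose $K^0\in\mathbb{K}$. Let $\alpha=C(K^0)$ and $$\xi=\frac{1}{\Lambda_{\min}(Q)}\Big(\frac{1+\|B\|_{\max}^2}{\mu}\alpha+\|R\|_{\max}\Big)-1,\qquad L=2\Big(\|R\|_{\max}+\|B\|_{\max}^2\Big(1+\frac{2\xi}{\|B\|_{\max}}\Big)\frac{\alpha}{\mu}\Big)\frac{\alpha}{\Lambda_{\min}(Q)}.$$ For any step size $0<\eta\le1/L$, the iterates of the gradient descent method $K^{n+1}=K^n-\eta\nabla C(K^n)$ all lie in $\mathbb{K}$ and satisfy, for all $n\ge0$, $$C(K^n)-C(K^* )\le\Big(1-\frac{2\mu^2\Lambda_{\min}(R)}{\|\mathbf{X}^{K^*}\|_{\max}}\eta\Big)^n\big(C(K^0)-C(K^* )\big).$$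
   Context: Let $N_s\ge 1$, $\Omega=\{1,\dots,N_s\}$. $\mathbb{M}^{N_s}_{n\times m}$ is the space of $N_s$-tuples $V=(V_1,\dots,V_{N_s})$ of real $n\times m$ matrices; $\|V\|_{\max}=\max_i\|V_i\|$ (spectral norm), $\Lambda_{\min}(V)=\min_i\sigma_{\min}(V_i)$. Markovian jump linear system: $x_{t+1}=A_{\omega(t)}x_t+B_{\omega(t)}u_t$, $A_i\in\mathbb{R}^{d\times d}$, $B_i\in\mathbb{R}^{d\times k}$, $B=(B_i)$; $\{\omega(t)\}$ is a time-homogeneous Markov chain on $\Omega$ with transition probabilities $p_{ij}$ and initial distribution $\pi$ with $\pi_i>0$; $x_0$ is random, independent of the chain, with $\mathbb{E}[x_0x_0^T]\succ0$. The system is mean-square stabilizable. $Q=(Q_i)\succ0$, $R=(R_i)\succ0$. For $K=(K_i)\in\mathbb{M}^{N_s}_{k\times d}$, $u_t=-K_{\omega(t)}x_t$ and $C(K)=\mathbb{E}[\sum_{t\ge0}x_t^TQ_{\omega(t)}x_t+u_t^TR_{\omega(t)}u_t]$. $\mathbb{K}$ is the set of $K$ making the closed loop $x_{t+1}=\Gamma_{\omega(t)}x_t$, $\Gamma_i=A_i-B_iK_i$, mean-square stable (equivalently $C(K)<\infty$); $\nabla C(K)$ is the gradient of $C$ on $\mathbb{K}$ w.r.t. $\langle V,S\rangle=\sum_i\mathrm{tr}(V_i^TS_i)$. $K^*$ is the optimal gain minimizing $C$ over $\mathbb{K}$. $\mu=\min_i\pi_i\,\sigma_{\min}(\mathbb{E}[x_0x_0^T])$.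 For $K\in\mathbb{K}$, with $\mathcal{T}_j(V)=\sum_ip_{ij}\Gamma_iV_i\Gamma_i^T$ and $X_i(0)=\mathbb{E}[x_0x_0^T\mathbf{1}\{\omega(0)=i\}]$, $\mathbf{X}^K=\sum_{t\ge0}\mathcal{T}^t(X(0))$. *)

theory Defs
  imports "HOL-Analysis.Analysis"
begin

(* Tuples V = (V_1,...,V_Ns) in M^Ns_{n x m} are elements of (real^'m^'n)^'s,
   where the finite type 's plays the role of Omega = {1..Ns}.
   The inner product of this euclidean space is sum_i tr(V_i^T S_i). *)

definition spec_norm :: "real^'m^'n \<Rightarrow> real" where
  "spec_norm M = onorm (\<lambda>x. M *v x)"

definition sigma_min :: "real^'n^'n \<Rightarrow> real" where
  "sigma_min M = Inf {norm (M *v x) | x. norm x = 1}"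

definition max_norm :: "(real^'m^'n)^'s::finite \<Rightarrow> real" where
  "max_norm V = Max (range (\<lambda>i. spec_norm (V $ i)))"

definition Lambda_min :: "(real^'n^'n)^'s::finite \<Rightarrow> real" where
  "Lambda_min V = Min (range (\<lambda>i. sigma_min (V $ i)))"

definition pos_def :: "real^'n^'n \<Rightarrow> bool" where
  "pos_def M \<longleftrightarrow> transpose M = M \<and> (\<forall>x. x \<noteq> 0 \<longrightarrow> x \<bullet> (M *v x) > 0)"

definition closed_loop :: "(real^'d^'d)^'s \<Rightarrow> (real^'k^'d)^'s \<Rightarrow> (real^'d^'k)^'s \<Rightarrow> (real^'d^'d)^'s" where
  "closed_loop A B K = (\<chi> i. A $ i - B $ i ** K $ i)"

primrec trans_mat :: "(real^'d^'d)^'s \<Rightarrow> (nat \<Rightarrow> 's) \<Rightarrow> nat \<Rightarrow> real^'d^'d" where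
  "trans_mat G w 0 = mat 1"
| "trans_mat G w (Suc t) = G $ (w t) ** trans_mat G w t"

definition paths :: "nat \<Rightarrow> (nat \<Rightarrow> 's) set" where
  "paths t = Pi\<^sub>E {..t} (\<lambda>_. UNIV)"

definition path_prob :: "('s \<Rightarrow> real) \<Rightarrow> ('s \<Rightarrow> 's \<Rightarrow> real) \<Rightarrow> (nat \<Rightarrow> 's) \<Rightarrow> nat \<Rightarrow> real" where
  "path_prob \<pi> p w t = \<pi> (w 0) * (\<Prod>s<t. p (w s) (w (Suc s)))"

(* mean-square stability of x_{t+1} = G_{omega(t)} x_t: for every deterministic initial
   state x0 and initial mode i0, E[|x_t|^2] -> 0 *)
definition ms_stable :: "('s::finite \<Rightarrow> 's \<Rightarrow> real) \<Rightarrow> (real^'d^'d)^'s \<Rightarrow> bool" where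
  "ms_stable p G \<longleftrightarrow> (\<forall>i0 x0.
     (\<lambda>t. \<Sum>w\<in>paths t. (if w 0 = i0 then (\<Prod>s<t. p (w s) (w (Suc s))) else 0)
            * (norm (trans_mat G w t *v x0))\<^sup>2) \<longlonglongrightarrow> 0)"

definition stab_gains :: "(real^'d^'d)^'s::finite \<Rightarrow> (real^'k^'d)^'s \<Rightarrow> ('s \<Rightarrow> 's \<Rightarrow> real)
    \<Rightarrow> ((real^'d^'k)^'s) set" where
  "stab_gains A B p = {K. ms_stable p (closed_loop A B K)}"

(* cost C(K) = E[sum_t x_t^T Q x_t + u_t^T R u_t], u_t = -K x_t, with
   Sigma0 = E[x0 x0^T], x0 independent of the chain *)
definition cost :: "(real^'d^'d)^'s::finite \<Rightarrow> (real^'k^'d)^'s \<Rightarrow> (real^'d^'d)^'s \<Rightarrow> (real^'k^'k)^'s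
    \<Rightarrow> ('s \<Rightarrow> 's \<Rightarrow> real) \<Rightarrow> ('s \<Rightarrow> real) \<Rightarrow> real^'d^'d \<Rightarrow> (real^'d^'k)^'s \<Rightarrow> real" where
  "cost A B Q R p \<pi> Sigma0 K =
     (\<Sum>t. \<Sum>w\<in>paths t. path_prob \<pi> p w t *
        trace ((Q $ (w t) + transpose (K $ (w t)) ** R $ (w t) ** K $ (w t))
               ** trans_mat (closed_loop A B K) w t ** Sigma0
               ** transpose (trans_mat (closed_loop A B K) w t)))"

definition grad :: "('a::real_inner \<Rightarrow> real) \<Rightarrow> 'a \<Rightarrow> 'a" where
  "grad f x = (THE D. GDERIV f x :> D)"

definition T_op :: "('s::finite \<Rightarrow> 's \<Rightarrow> real) \<Rightarrow> (real^'d^'d)^'s \<Rightarrow> (real^'d^'d)^'s \<Rightarrow> (real^'d^'d)^'s" where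
  "T_op p G V = (\<chi> j. \<Sum>i\<in>UNIV. p i j *\<^sub>R (G $ i ** V $ i ** transpose (G $ i)))"

(* X^K = sum_t T^t(X(0)), X_i(0) = E[x0 x0^T 1{omega(0)=i}] = pi_i Sigma0 *)
definition XK :: "(real^'d^'d)^'s::finite \<Rightarrow> (real^'k^'d)^'s \<Rightarrow> ('s \<Rightarrow> 's \<Rightarrow> real) \<Rightarrow> ('s \<Rightarrow> real)
    \<Rightarrow> real^'d^'d \<Rightarrow> (real^'d^'k)^'s \<Rightarrow> (real^'d^'d)^'s" where
  "XK A B p \<pi> Sigma0 K = (\<Sum>t. (T_op p (closed_loop A B K) ^^ t) (\<chi> i. \<pi> i *\<^sub>R Sigma0))"

end

theory Submission
  imports Defs
begin

text \<open>
  With \<open>P\<close> the solution of \<open>P\<^sub>i = Q\<^sub>i + K\<^sub>i\<^sup>T R\<^sub>i K\<^sub>i + \<Gamma>\<^sub>i\<^sup>T (\<Sum>\<^sub>j p\<^sub>i\<^sub>j P\<^sub>j) \<Gamma>\<^sub>i\<close> one has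
  \<open>C(K) = \<langle>P, X(0)\<rangle>\<close> and \<open>\<nabla>C(K) = 2 M X\<close>, and for two stabilizing gains \<open>C(K') - C(K)\<close> is an
  explicit quadratic in \<open>K' - K\<close> paired with \<open>X\<close> at \<open>K'\<close>. Completing the square at \<open>K' = K\<^sup>*\<close> bounds
  \<open>C(K) - C(K\<^sup>*)\<close> by a multiple of \<open>|\<nabla>C(K)|\<^sup>2\<close>.

  On the sublevel set of \<open>\<alpha>\<close> we have \<open>P \<le> \<alpha>/\<mu>\<close> and \<open>tr X \<le> \<alpha>/\<Lambda>\<^sub>m\<^sub>i\<^sub>n(Q)\<close>. Along a unit direction the
  derivative \<open>P'\<close> solves the same Lyapunov equation with a source between \<open>-\<xi> Q\<close> and \<open>\<xi> Q\<close>, so that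
  \<open>-\<xi> P \<le> P' \<le> \<xi> P\<close>, and the second derivative of the cost is at most \<open>L\<close>. As \<open>P\<close> is a Lyapunov
  function in a neighbourhood of \<open>K\<close> whose size depends on \<open>\<alpha>\<close> only, the segment from \<open>K\<close> to
  \<open>K - \<eta> \<nabla>C(K)\<close> cannot leave the sublevel set, and Taylor's formula gives a decrease by at least
  \<open>\<eta>/2 |\<nabla>C(K)|\<^sup>2\<close>.
\<close>

section \<open>Matrices and quadratic forms\<close>

text \<open>Stability enters only as geometric decay of the powers of two adjoint operators,
  \<open>T_adj\<close> on cost-to-go matrices and \<open>T_op\<close> on second moments. Both
  Lyapunov equations are then solved by Neumann series, and a bound on a source of the first becomes
  a scalar bound after pairing with \<open>X\<close>, the solution of the second.

  Two obstacles shape the rest. A supremum argument resolves the circle. Secondly, the second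
  derivative contains P' between the two different vectors B U x and \<Gamma> x, hence order
  relations are stated for bilinear forms. The resulting mixed term is linear in the norm of B,
  which is the origin of the quotient 2 \<xi> / |B| in L.

  The rate is the product of \<eta>/2, from the decrease, and the dominance constant 4 \<mu>^2
  \<Lambda>_min(R) / |X|, with X taken at the optimum.\<close>

declare transpose_matrix_vector [simp del]

text \<open>Replaces the library's rewriting of transposed products into \<open>v*\<close>: adjoints
  are moved across the inner product, so that every form is normalized to products
  \<open>*v\<close>.\<close>

lemma inner_transpose_matrix_vector [simp]:
  fixes M :: "real^'n^'m"
  shows "x \<bullet> (transpose M *v y) = (M *v x) \<bullet> y"
  by (metis dot_lmul_matrix inner_commute transpose_matrix_vector)

lemma inner_matrix_vector_sym:
  fixes M :: "real^'n^'n"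
  assumes "transpose M = M"
  shows "x \<bullet> (M *v y) = y \<bullet> (M *v x)"
  by (metis assms inner_commute inner_transpose_matrix_vector)

lemma matrix_eqI_inner:
  fixes M N :: "real^'n^'m"
  assumes "\<And>x y. x \<bullet> (M *v y) = x \<bullet> (N *v y)"
  shows "M = N"
proof -
  have "M *v y = N *v y" for y
    using assms[of _ y] vector_eq_ldot[of "M *v y" "N *v y"] by blast
  then show ?thesis by (simp add: matrix_eq)
qed

lemma sum_matrix_vector_mult:
  fixes f :: "'a \<Rightarrow> real^'n^'m"
  shows "(\<Sum>j\<in>S. f j) *v x = (\<Sum>j\<in>S. f j *v x)"
  by (induction S rule: infinite_finite_induct) (simp_all add: matrix_vector_mult_add_rdistrib)

lemma transpose_add: "transpose (M + N) = transpose M + transpose (N :: real^'n^'m)"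
  by (simp add: transpose_def vec_eq_iff)

lemma inner_transpose_transpose:
  fixes M N :: "real^'n^'m"
  shows "transpose M \<bullet> transpose N = M \<bullet> N"
  by (simp add: inner_vec_def transpose_def) (rule sum.swap)

text \<open>Cyclicity of the trace, since the inner product of matrices is the Frobenius
  product.\<close>

lemma inner_matrix_mult_left:
  fixes M :: "real^'k^'m" and N :: "real^'n^'k"
  shows "(M ** N) \<bullet> S = N \<bullet> (transpose M ** S)"
proof -
  have "(M ** N) \<bullet> S = (\<Sum>i\<in>UNIV. \<Sum>j\<in>UNIV. \<Sum>k\<in>UNIV. M$i$k * N$k$j * S$i$j)"
    by (simp add: inner_vec_def matrix_matrix_mult_def sum_distrib_right)
  also have "\<dots> = (\<Sum>i\<in>UNIV. \<Sum>k\<in>UNIV. \<Sum>j\<in>UNIV. M$i$k * N$k$j * S$i$j)"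
    by (intro sum.cong refl) (rule sum.swap)
  also have "\<dots> = (\<Sum>k\<in>UNIV. \<Sum>i\<in>UNIV. \<Sum>j\<in>UNIV. M$i$k * N$k$j * S$i$j)"
    by (rule sum.swap)
  also have "\<dots> = (\<Sum>k\<in>UNIV. \<Sum>j\<in>UNIV. \<Sum>i\<in>UNIV. M$i$k * N$k$j * S$i$j)"
    by (intro sum.cong refl) (rule sum.swap)
  also have "\<dots> = N \<bullet> (transpose M ** S)"
    by (simp add: inner_vec_def matrix_matrix_mult_def sum_distrib_left transpose_def mult_ac)
  finally show ?thesis .
qed

lemma inner_matrix_mult_right:
  fixes M :: "real^'k^'m" and N :: "real^'n^'k"
  shows "(M ** N) \<bullet> S = M \<bullet> (S ** transpose N)"
proof -
  have "(M ** N) \<bullet> S = (transpose N ** transpose M) \<bullet> transpose S"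
    by (metis inner_transpose_transpose matrix_transpose_mul)
  also have "\<dots> = transpose M \<bullet> transpose (S ** transpose N)"
    by (simp add: inner_matrix_mult_left matrix_transpose_mul)
  finally show ?thesis by (simp add: inner_transpose_transpose)
qed

lemma trace_matrix_mult_inner:
  fixes M :: "real^'n^'m"
  shows "trace (M ** N) = transpose M \<bullet> N"
  by (simp add: trace_def inner_vec_def matrix_matrix_mult_def transpose_def) (rule sum.swap)

text \<open>The rank-one matrix u v^T. Pairing with it makes the evaluation of a form a linear
  functional of the matrix.\<close>

definition outer :: "real^'m \<Rightarrow> real^'n \<Rightarrow> real^'n^'m" where
  "outer u v = (\<chi> i j. u $ i * v $ j)"

lemma outer_matrix_vector_mult [simp]: "outer u v *v y = (v \<bullet> y) *\<^sub>R u"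
  by (simp add: outer_def matrix_vector_mult_def inner_vec_def vec_eq_iff sum_distrib_left mult_ac)

lemma inner_outer [simp]: "M \<bullet> outer u v = u \<bullet> (M *v v)"
  by (simp add: outer_def inner_vec_def matrix_vector_mult_def sum_distrib_left mult_ac)

lemma matrix_mult_outer:
  "M ** outer u v ** transpose N = outer (M *v u) (N *v v)"
  by (rule matrix_eqI_inner)
     (simp add: matrix_vector_mul_assoc[symmetric] matrix_vector_mult_scaleR inner_commute)

lemma norm_matrix_vector_le:
  fixes M :: "real^'n^'m"
  shows "norm (M *v x) \<le> norm M * norm x"
proof -
  have "norm (M *v x) = L2_set (\<lambda>i. \<bar>M$i \<bullet> x\<bar>) UNIV"
    by (simp add: norm_vec_def[of "M *v x"] matrix_vector_mul_component)
  also have "\<dots> \<le> L2_set (\<lambda>i. norm (M$i) * norm x) UNIV"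
    by (rule L2_set_mono) (simp_all add: Cauchy_Schwarz_ineq2)
  also have "\<dots> = norm M * norm x"
    by (simp add: norm_vec_def[of M] L2_set_left_distrib)
  finally show ?thesis .
qed

lemma norm_matrix_mult_le:
  fixes M :: "real^'k^'m" and N :: "real^'n^'k"
  shows "norm (M ** N) \<le> norm M * norm N"
proof -
  have row: "norm ((M ** N) $ i) \<le> norm (M $ i) * norm N" for i
  proof -
    have "(M ** N) $ i = transpose N *v (M $ i)"
      by (simp add: matrix_matrix_mult_def matrix_vector_mult_def transpose_def vec_eq_iff mult_ac)
    moreover have "norm (transpose N) = norm N"
      by (simp add: norm_eq_sqrt_inner inner_transpose_transpose)
    ultimately show ?thesis
      using norm_matrix_vector_le[of "transpose N" "M $ i"] by (simp add: mult.commute)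
  qed
  have "norm (M ** N) \<le> L2_set (\<lambda>i. norm (M $ i) * norm N) UNIV"
    unfolding norm_vec_def[of "M ** N"] by (rule L2_set_mono) (simp_all add: row)
  also have "\<dots> = norm M * norm N"
    by (simp add: norm_vec_def[of M] L2_set_left_distrib)
  finally show ?thesis .
qed

lemma matrix_scaleR_left: "(r *\<^sub>R M) ** N = r *\<^sub>R (M ** (N :: real^'n^'k))"
  by (simp add: matrix_matrix_mult_def vec_eq_iff sum_distrib_left mult_ac)

lemma matrix_scaleR_right: "M ** (r *\<^sub>R N) = r *\<^sub>R (M ** (N :: real^'n^'k))"
  by (simp add: matrix_matrix_mult_def vec_eq_iff sum_distrib_left mult_ac)

lemma bounded_bilinear_matrix_mult:
  "bounded_bilinear ((**) :: real^'k^'m \<Rightarrow> real^'n^'k \<Rightarrow> real^'n^'m)"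
proof
  show "\<exists>K. \<forall>a b. norm ((a :: real^'k^'m) ** (b :: real^'n^'k)) \<le> norm a * norm b * K"
    by (rule exI[of _ 1]) (simp add: norm_matrix_mult_le)
qed (simp_all add: matrix_add_ldistrib matrix_scaleR_left matrix_scaleR_right,
     simp add: matrix_matrix_mult_def vec_eq_iff sum.distrib distrib_right)

lemmas matrix_mult_add_left = bounded_bilinear.add_left [OF bounded_bilinear_matrix_mult]
lemmas tendsto_matrix_mult [tendsto_intros] =
  bounded_bilinear.tendsto [OF bounded_bilinear_matrix_mult]

lemma bounded_linear_transpose: "bounded_linear (transpose :: real^'n^'m \<Rightarrow> real^'m^'n)"
proof
  show "\<exists>K. \<forall>x. norm (transpose (x :: real^'n^'m)) \<le> norm x * K"
    by (rule exI[of _ 1]) (simp add: norm_eq_sqrt_inner inner_transpose_transpose)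
qed (simp_all add: transpose_add transpose_scalar)

lemmas tendsto_transpose [tendsto_intros] = bounded_linear.tendsto [OF bounded_linear_transpose]

section \<open>Bounds by the spectral norm\<close>

lemma norm_le_spec_norm: "norm (M *v x) \<le> spec_norm M * norm x"
  unfolding spec_norm_def
  by (rule onorm) (rule linear_conv_bounded_linear[THEN iffD1, OF matrix_vector_mul_linear])

lemma spec_norm_le_max_norm: "spec_norm (V $ i) \<le> max_norm V"
  unfolding max_norm_def by (rule Max_ge) auto

lemma spec_norm_nonneg: "0 \<le> spec_norm M"
  unfolding spec_norm_def
  by (rule onorm_pos_le) (rule linear_conv_bounded_linear[THEN iffD1, OF matrix_vector_mul_linear])

lemma max_norm_nonneg: "0 \<le> max_norm V"
  using spec_norm_nonneg spec_norm_le_max_norm order_trans by blast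

lemma norm_le_max_norm: "norm (V $ i *v x) \<le> max_norm V * norm x"
  by (meson mult_right_mono norm_ge_zero norm_le_spec_norm order_trans spec_norm_le_max_norm)

lemma form_le_max_norm: "x \<bullet> (V $ i *v x) \<le> max_norm V * (x \<bullet> x)"
proof -
  have "x \<bullet> (V $ i *v x) \<le> norm x * norm (V $ i *v x)" by (rule norm_cauchy_schwarz)
  also have "\<dots> \<le> norm x * (max_norm V * norm x)"
    by (intro mult_left_mono norm_le_max_norm) simp
  finally show ?thesis by (simp add: dot_square_norm power2_eq_square mult_ac)
qed

section \<open>Positive semidefinite matrices\<close>

definition psd :: "real^'n^'n \<Rightarrow> bool" where
  "psd M \<longleftrightarrow> transpose M = M \<and> (\<forall>x. 0 \<le> x \<bullet> (M *v x))"

lemma pos_def_imp_psd: "pos_def M \<Longrightarrow> psd M"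
  unfolding pos_def_def psd_def by (metis inner_zero_left order_le_less)

lemma psd_cauchy_schwarz:
  assumes "psd M"
  shows "(x \<bullet> (M *v y))\<^sup>2 \<le> (x \<bullet> (M *v x)) * (y \<bullet> (M *v y))"
proof -
  let ?a = "x \<bullet> (M *v x)" and ?b = "x \<bullet> (M *v y)" and ?c = "y \<bullet> (M *v y)"
  have q: "0 \<le> ?a + 2 * t * ?b + t\<^sup>2 * ?c" for t
  proof -
    have "y \<bullet> (M *v x) = ?b" using assms unfolding psd_def by (metis inner_matrix_vector_sym)
    then have "(x + t *\<^sub>R y) \<bullet> (M *v (x + t *\<^sub>R y)) = ?a + 2 * t * ?b + t\<^sup>2 * ?c"
      by (simp add: matrix_vector_right_distrib matrix_vector_mult_scaleR inner_left_distrib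
          inner_right_distrib power2_eq_square algebra_simps)
    then show ?thesis using assms unfolding psd_def by metis
  qed
  show ?thesis
  proof (cases "?c = 0")
    case True
    have "?b = 0"
    proof (rule ccontr)
      assume b: "?b \<noteq> 0"
      \<comment> \<open>With \<open>?c = 0\<close> the quadratic is affine in t and takes the value
        -1 at this point.\<close>
      from q[of "- (?a + 1) / (2 * ?b)"] True b show False by (simp add: field_simps)
    qed
    then show ?thesis using True by simp
  next
    case False
    then have c: "?c > 0" using assms unfolding psd_def by (metis order_le_less)
    \<comment> \<open>The quadratic at its minimizer -b/c, scaled by c.\<close>
    have "0 \<le> ?c * (?a + 2 * (- ?b / ?c) * ?b + (- ?b / ?c)\<^sup>2 * ?c)"
      using q[of "- ?b / ?c"] c by (intro mult_nonneg_nonneg) auto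
    also have "\<dots> = ?a * ?c - ?b\<^sup>2" using c by (simp add: field_simps power2_eq_square)
    finally show ?thesis by simp
  qed
qed

lemma psd_young:
  assumes "psd M"
  shows "x \<bullet> (M *v y) \<le> (x \<bullet> (M *v x) + y \<bullet> (M *v y)) / 2"
proof -
  have "0 \<le> (x - y) \<bullet> (M *v (x - y))" using assms unfolding psd_def by blast
  moreover have "y \<bullet> (M *v x) = x \<bullet> (M *v y)"
    using assms unfolding psd_def by (metis inner_matrix_vector_sym)
  ultimately show ?thesis by (simp add: algebra_simps)
qed

text \<open>Cauchy-Schwarz for the form of M, applied to M x and x, forces |M x| = 0.\<close>

lemma psd_null_vector:
  assumes "psd M" and "x \<bullet> (M *v x) = 0"
  shows "M *v x = 0"
  using psd_cauchy_schwarz[OF assms(1), of "M *v x" x] assms(2) by simp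

text \<open>One elimination step of the Cholesky algorithm per index of \<open>S\<close>.\<close>

lemma psd_sum_of_squares_aux:
  fixes M :: "real^'n^'n"
  assumes "finite S"
  shows "psd M \<Longrightarrow> (\<forall>a. a \<notin> S \<longrightarrow> M *v axis a 1 = 0) \<Longrightarrow>
    \<exists>v. \<forall>x y. x \<bullet> (M *v y) = (\<Sum>a\<in>S. (x \<bullet> v a) * (y \<bullet> (v a :: real^'n)))"
  using assms
proof (induction S arbitrary: M rule: finite_induct)
  case empty
  have "M *v y = 0" for y
  proof -
    have "M *v y = (\<Sum>i\<in>UNIV. y $ i *s column i M)" by (rule matrix_mult_sum)
    also have "\<dots> = 0" using empty by (simp add: matrix_vector_mult_basis)
    finally show ?thesis .
  qed
  then show ?case by simp
next
  case (insert a S)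
  let ?e = "axis a 1 :: real^'n"
  define u where "u = M *v ?e"
  define q where "q = ?e \<bullet> u"
  have sym: "x \<bullet> (M *v y) = y \<bullet> (M *v x)" for x y
    using insert.prems(1) unfolding psd_def by (metis inner_matrix_vector_sym)
  show ?case
  proof (cases "q = 0")
    \<comment> \<open>A zero pivot: the coordinate vector already lies in the kernel, so there is
      nothing to eliminate and its square is taken to be 0.\<close>
    case True
    then have "M *v ?e = 0"
      using psd_null_vector[OF insert.prems(1), of ?e] by (simp add: q_def u_def)
    then have "\<forall>b. b \<notin> S \<longrightarrow> M *v axis b 1 = 0" using insert.prems(2) by auto
    from insert.IH[OF insert.prems(1) this] obtain v where
      v: "\<And>x y. x \<bullet> (M *v y) = (\<Sum>a\<in>S. (x \<bullet> v a) * (y \<bullet> v a))" by blast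
    have "x \<bullet> (M *v y) = (\<Sum>b\<in>insert a S. (x \<bullet> (v(a := 0)) b) * (y \<bullet> (v(a := 0)) b))" for x y
      using insert.hyps by (auto simp: v intro!: sum.cong)
    then show ?thesis by blast
  next
    case False
    then have q: "q > 0"
      using insert.prems(1) unfolding psd_def q_def u_def by (metis order_le_less)
    \<comment> \<open>The Schur complement of the pivot. It annihilates the coordinate vector of
      \<open>a\<close>, and by Cauchy-Schwarz it is again positive semidefinite.\<close>
    define N where "N = M - (1 / q) *\<^sub>R outer u u"
    have N: "x \<bullet> (N *v y) = x \<bullet> (M *v y) - (x \<bullet> u) * (y \<bullet> u) / q" for x y
      by (simp add: N_def matrix_vector_mult_diff_rdistrib inner_diff_right inner_commute
          scaleR_matrix_vector_assoc[symmetric])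
    have "psd N"
      unfolding psd_def
    proof (intro conjI allI)
      show "transpose N = N"
      proof (rule matrix_eqI_inner)
        fix x y
        show "x \<bullet> (transpose N *v y) = x \<bullet> (N *v y)"
          using N[of y x] N[of x y] sym[of x y] by (simp add: inner_commute mult.commute)
      qed
      fix x
      have "(x \<bullet> u)\<^sup>2 \<le> (x \<bullet> (M *v x)) * q"
        unfolding q_def u_def by (rule psd_cauchy_schwarz[OF insert.prems(1)])
      then show "0 \<le> x \<bullet> (N *v x)" using q by (simp add: N field_simps power2_eq_square)
    qed
    moreover have "\<forall>b. b \<notin> S \<longrightarrow> N *v axis b 1 = 0"
    proof (intro allI impI)
      fix b assume "b \<notin> S"
      show "N *v axis b 1 = 0"
      proof (cases "b = a")
        case True
        have "x \<bullet> (N *v ?e) = 0" for x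
          using q by (simp add: N u_def[symmetric] q_def[symmetric])
        then show ?thesis using True by (metis inner_eq_zero_iff)
      next
        case False
        then have z: "M *v axis b 1 = 0" using insert.prems(2) \<open>b \<notin> S\<close> by simp
        then have "axis b 1 \<bullet> u = 0" unfolding u_def by (subst sym) simp
        then have "x \<bullet> (N *v axis b 1) = 0" for x by (simp add: N z)
        then show ?thesis by (metis inner_eq_zero_iff)
      qed
    qed
    ultimately obtain v where
      v: "\<And>x y. x \<bullet> (N *v y) = (\<Sum>a\<in>S. (x \<bullet> v a) * (y \<bullet> v a))"
      using insert.IH[of N] by blast
    let ?v = "v(a := (1 / sqrt q) *\<^sub>R u)"
    have "x \<bullet> (M *v y) = (\<Sum>b\<in>insert a S. (x \<bullet> ?v b) * (y \<bullet> ?v b))" for x y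
    proof -
      have "(\<Sum>b\<in>S. (x \<bullet> ?v b) * (y \<bullet> ?v b)) = x \<bullet> (N *v y)"
        using insert.hyps by (auto simp: v intro!: sum.cong)
      then show ?thesis using insert.hyps q by (simp add: N)
    qed
    then show ?thesis by blast
  qed
qed

text \<open>Writes X as a sum of rank-one matrices, without diagonalizing it. This is how pointwise
  inequalities between quadratic forms survive pairing with X.\<close>

lemma psd_sum_of_squares:
  fixes X :: "real^'n^'n"
  assumes "psd X"
  shows "\<exists>v :: 'n \<Rightarrow> real^'n. \<forall>N. N \<bullet> X = (\<Sum>a\<in>UNIV. v a \<bullet> (N *v v a))"
proof -
  obtain v :: "'n \<Rightarrow> real^'n" where
    v: "\<And>x y. x \<bullet> (X *v y) = (\<Sum>a\<in>UNIV. (x \<bullet> v a) * (y \<bullet> v a))"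
    using psd_sum_of_squares_aux[OF _ assms, of UNIV] by auto
  have "X = (\<Sum>a\<in>UNIV. outer (v a) (v a))"
    by (rule matrix_eqI_inner)
       (simp add: v sum_matrix_vector_mult inner_sum_right inner_commute mult.commute)
  then have "N \<bullet> X = (\<Sum>a\<in>UNIV. v a \<bullet> (N *v v a))" for N
    by (simp add: inner_sum_right)
  then show ?thesis by blast
qed

lemma psd_inner_mono:
  fixes X :: "real^'n^'n"
  assumes "psd X" and "\<And>x. x \<bullet> (M *v x) \<le> x \<bullet> (N *v x)"
  shows "M \<bullet> X \<le> N \<bullet> X"
proof -
  obtain v :: "'n \<Rightarrow> real^'n" where v: "\<And>N. N \<bullet> X = (\<Sum>a\<in>UNIV. v a \<bullet> (N *v v a))"
    using psd_sum_of_squares[OF assms(1)] by blast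
  show ?thesis unfolding v by (intro sum_mono assms(2))
qed

text \<open>By Cauchy-Schwarz x x^T is at most |x|^2 times the identity; pairing both with M gives
  the form and the trace.\<close>

lemma psd_form_le_trace:
  assumes "psd M"
  shows "x \<bullet> (M *v x) \<le> (mat 1 \<bullet> M) * (x \<bullet> x)"
proof -
  have "outer x x \<bullet> M \<le> ((x \<bullet> x) *\<^sub>R mat 1) \<bullet> M"
  proof (rule psd_inner_mono[OF assms])
    fix y
    have "(x \<bullet> y)\<^sup>2 \<le> (x \<bullet> x) * (y \<bullet> y)" by (rule Cauchy_Schwarz_ineq)
    then show "y \<bullet> (outer x x *v y) \<le> y \<bullet> (((x \<bullet> x) *\<^sub>R mat 1) *v y)"
      by (simp add: scaleR_matrix_vector_assoc[symmetric] power2_eq_square inner_commute)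
  qed
  then show ?thesis by (simp add: inner_commute[of "outer x x"] mult.commute)
qed

lemma psd_gram: "psd (transpose M ** M)" for M :: "real^'n^'m"
  by (simp add: psd_def matrix_transpose_mul matrix_vector_mul_assoc[symmetric])

section \<open>Smallest singular values of positive definite matrices\<close>

lemma sigma_min_bdd_below: "bdd_below {norm (M *v x) | x. norm x = 1}"
  by (rule bdd_belowI[of _ 0]) auto

text \<open>\<open>sigma_min\<close> is an infimum of |M x|, not of the form, so it must be
  identified with the least value q of the form on the sphere. A minimizer z is a null vector of the
  semidefinite matrix M - q I, hence an eigenvector with |M z| = q.\<close>

lemma pos_def_form_ge_sigma_min:
  fixes M :: "real^'n^'n"
  assumes "pos_def M"
  shows "sigma_min M * (x \<bullet> x) \<le> x \<bullet> (M *v x)" and "0 < sigma_min M"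
proof -
  let ?S = "sphere (0 :: real^'n) 1" and ?q = "\<lambda>x. x \<bullet> (M *v x)"
  have "?S \<noteq> {}" by simp
  moreover have "continuous_on ?S ?q"
    by (intro continuous_intros matrix_vector_mult_linear_continuous_on)
  ultimately obtain z where z: "z \<in> ?S" "\<And>y. y \<in> ?S \<Longrightarrow> ?q z \<le> ?q y"
    using continuous_attains_inf[of ?S ?q] by auto
  have nz: "norm z = 1" using z(1) by simp
  have pos: "?q z > 0" using assms nz unfolding pos_def_def by (cases "z = 0") auto
  have q: "?q z * (y \<bullet> y) \<le> ?q y" for y
  proof (cases "y = 0")
    case False
    have "?q z \<le> ?q ((1 / norm y) *\<^sub>R y)" using False by (intro z(2)) simp
    also have "\<dots> = ?q y / (y \<bullet> y)"
      by (simp add: matrix_vector_mult_scaleR dot_square_norm power2_eq_square)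
    finally show ?thesis using False by (simp add: field_simps)
  qed simp
  have "?q z \<le> norm (M *v y)" if "norm y = 1" for y
    using q[of y] norm_cauchy_schwarz[of y "M *v y"] that by (simp add: dot_square_norm)
  then have "?q z \<le> sigma_min M"
    unfolding sigma_min_def using nz by (intro cInf_greatest) auto
  then show "0 < sigma_min M" using pos by simp
  let ?N = "M - ?q z *\<^sub>R mat 1"
  have N: "?N *v y = M *v y - ?q z *\<^sub>R y" for y
    by (simp add: matrix_vector_mult_diff_rdistrib scaleR_matrix_vector_assoc[symmetric])
  have "psd ?N"
    unfolding psd_def
  proof (intro conjI allI)
    have "transpose M = M" using assms unfolding pos_def_def by simp
    then show "transpose ?N = ?N" by (simp add: transpose_def vec_eq_iff mat_def)
    show "0 \<le> y \<bullet> (?N *v y)" for y using q[of y] by (simp add: N inner_diff_right)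
  qed
  moreover have "z \<bullet> (?N *v z) = 0" using nz by (simp add: N inner_diff_right dot_square_norm)
  ultimately have "M *v z = ?q z *\<^sub>R z" using psd_null_vector N by fastforce
  then have "norm (M *v z) = ?q z" using nz pos by (metis abs_of_pos mult.right_neutral norm_scaleR)
  moreover have "sigma_min M \<le> norm (M *v z)"
    unfolding sigma_min_def using nz by (intro cInf_lower sigma_min_bdd_below) auto
  ultimately have "sigma_min M \<le> ?q z" by simp
  then have "sigma_min M * (x \<bullet> x) \<le> ?q z * (x \<bullet> x)" by (intro mult_right_mono) auto
  then show "sigma_min M * (x \<bullet> x) \<le> x \<bullet> (M *v x)" using q[of x] by simp
qed

lemma Lambda_min_pos:
  assumes "\<And>i. pos_def (V $ i)"
  shows "0 < Lambda_min V"
  unfolding Lambda_min_def using pos_def_form_ge_sigma_min(2)[OF assms]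
  by (subst Min_gr_iff) auto

lemma form_ge_Lambda_min:
  assumes "\<And>i. pos_def (V $ i)"
  shows "Lambda_min V * (x \<bullet> x) \<le> x \<bullet> (V $ i *v x)"
proof -
  have "Lambda_min V \<le> sigma_min (V $ i)" unfolding Lambda_min_def by (rule Min_le) auto
  then have "Lambda_min V * (x \<bullet> x) \<le> sigma_min (V $ i) * (x \<bullet> x)" by (intro mult_right_mono) auto
  then show ?thesis using pos_def_form_ge_sigma_min(1)[OF assms, of i x] by linarith
qed

section \<open>Neumann series\<close>

text \<open>A bound on all powers instead of a norm below one: in finite dimension this says that
  the spectral radius is below one, independently of the norm.\<close>

definition geometric :: "('a::real_normed_vector \<Rightarrow> 'a) \<Rightarrow> bool" where
  "geometric f \<longleftrightarrow> bounded_linear f \<and>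
     (\<exists>c \<rho>. 0 \<le> \<rho> \<and> \<rho> < 1 \<and> (\<forall>t v. norm ((f ^^ t) v) \<le> c * \<rho> ^ t * norm v))"

text \<open>For geometric \<open>f\<close> this is the resolvent (id - f)^-1.\<close>

definition neumann :: "('a::real_normed_vector \<Rightarrow> 'a) \<Rightarrow> 'a \<Rightarrow> 'a" where
  "neumann f v = (\<Sum>t. (f ^^ t) v)"

lemma geometric_bounded_linear: "geometric f \<Longrightarrow> bounded_linear f"
  by (simp add: geometric_def)

lemma geometric_summable:
  fixes f :: "'a::banach \<Rightarrow> 'a"
  assumes "geometric f"
  shows "summable (\<lambda>t. (f ^^ t) v)"
proof -
  obtain c \<rho> where c: "0 \<le> \<rho>" "\<rho> < 1" "\<And>t v. norm ((f ^^ t) v) \<le> c * \<rho> ^ t * norm v"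
    using assms unfolding geometric_def by blast
  have "summable (\<lambda>t. c * norm v * \<rho> ^ t)"
    using c(1,2) by (intro summable_mult summable_geometric) simp
  then show ?thesis
    by (rule summable_comparison_test') (use c(3)[of _ v] in \<open>simp add: mult_ac\<close>)
qed

lemma neumann_sums:
  fixes f :: "'a::banach \<Rightarrow> 'a"
  shows "geometric f \<Longrightarrow> (\<lambda>t. (f ^^ t) v) sums neumann f v"
  unfolding neumann_def by (rule summable_sums) (rule geometric_summable)

lemma neumann_unfold:
  fixes f :: "'a::banach \<Rightarrow> 'a"
  assumes "geometric f"
  shows "neumann f v = v + f (neumann f v)"
proof -
  have "(\<lambda>t. (f ^^ Suc t) v) sums f (neumann f v)"
    using bounded_linear.sums[OF geometric_bounded_linear neumann_sums, OF assms assms] by simp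
  then have "(\<lambda>t. (f ^^ t) v) sums (f (neumann f v) + (f ^^ 0) v)"
    by (rule sums_Suc)
  then have "neumann f v = f (neumann f v) + (f ^^ 0) v"
    by (rule sums_unique2[OF neumann_sums[OF assms]])
  then show ?thesis by (metis add.commute funpow_0)
qed

lemma linear_funpow: "linear (f :: 'a::real_vector \<Rightarrow> 'a) \<Longrightarrow> linear (f ^^ t)"
  by (induction t) (auto intro: linear_id linear_compose)

lemma linear_neumann:
  fixes f :: "'a::banach \<Rightarrow> 'a"
  assumes "geometric f"
  shows "linear (neumann f)"
proof -
  have lin: "linear (f ^^ t)" for t
    using assms geometric_bounded_linear bounded_linear.linear linear_funpow by blast
  show ?thesis
  proof (rule linearI)
    fix u v and r :: real
    show "neumann f (u + v) = neumann f u + neumann f v"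
      using sums_add[OF neumann_sums neumann_sums, OF assms assms, of u v]
        neumann_sums[OF assms, of "u + v"] sums_unique2
      by (fastforce simp: linear_add[OF lin])
    show "neumann f (r *\<^sub>R v) = r *\<^sub>R neumann f v"
      using sums_scaleR_right[OF neumann_sums[OF assms, of v], of r]
        neumann_sums[OF assms, of "r *\<^sub>R v"] sums_unique2
      by (fastforce simp: linear_cmul[OF lin])
  qed
qed

lemma neumann_left_inverse:
  fixes f :: "'a::banach \<Rightarrow> 'a"
  assumes "geometric f"
  shows "neumann f (v - f v) = v"
proof -
  have lin: "linear f" using assms geometric_bounded_linear bounded_linear.linear by blast
  have "(\<lambda>t. (f ^^ t) (f v)) sums f (neumann f v)"
    using bounded_linear.sums[OF geometric_bounded_linear neumann_sums, OF assms assms]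
    by (simp add: funpow_swap1)
  then have "neumann f (f v) = f (neumann f v)"
    using neumann_sums[OF assms] sums_unique2 by blast
  then show ?thesis
    using neumann_unfold[OF assms, of v]
    by (metis add_diff_cancel_right' linear_diff[OF linear_neumann[OF assms]])
qed

lemma neumann_unique:
  fixes f :: "'a::banach \<Rightarrow> 'a"
  assumes "geometric f" and "v = w + f v"
  shows "v = neumann f w"
  using neumann_left_inverse[OF assms(1), of v] assms(2) by (metis add_diff_cancel_right')

lemma funpow_adjoint:
  fixes f g :: "'a::real_inner \<Rightarrow> 'a"
  assumes "\<And>x y. f x \<bullet> y = x \<bullet> g y"
  shows "(f ^^ t) x \<bullet> y = x \<bullet> (g ^^ t) y"
  by (induction t arbitrary: x) (simp_all add: assms funpow_swap1)

text \<open>Powers of adjoint operators have the same norm bound: pair g^t y with itself, move the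
  power onto f, and cancel one factor |g^t y|.\<close>

lemma geometric_adjoint:
  fixes f g :: "'a::real_inner \<Rightarrow> 'a"
  assumes "geometric f" and adj: "\<And>x y. f x \<bullet> y = x \<bullet> g y" and "bounded_linear g"
  shows "geometric g"
proof -
  obtain c \<rho> where c: "0 \<le> \<rho>" "\<rho> < 1" "\<And>t v. norm ((f ^^ t) v) \<le> c * \<rho> ^ t * norm v"
    using assms unfolding geometric_def by blast
  have "norm ((g ^^ t) y) \<le> c * \<rho> ^ t * norm y" for t y
  proof (cases "(g ^^ t) y = 0")
    case False
    let ?z = "(g ^^ t) y"
    have "norm ?z * norm ?z = ?z \<bullet> ?z" by (simp add: dot_square_norm power2_eq_square)
    also have "\<dots> = (f ^^ t) ?z \<bullet> y" by (simp add: funpow_adjoint[OF adj])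
    also have "\<dots> \<le> norm ((f ^^ t) ?z) * norm y" by (rule norm_cauchy_schwarz)
    also have "\<dots> \<le> (c * \<rho> ^ t * norm ?z) * norm y" by (intro mult_right_mono c) simp
    finally have "norm ?z * norm ?z \<le> norm ?z * (c * \<rho> ^ t * norm y)" by (simp add: mult_ac)
    then show ?thesis using False by (simp add: mult_le_cancel_left)
  next
    case True
    have "0 \<le> c * \<rho> ^ t * norm y" using c(3)[of t y] norm_ge_zero order_trans by blast
    then show ?thesis using True by simp
  qed
  then show ?thesis using assms(3) c(1,2) unfolding geometric_def by blast
qed

lemma neumann_adjoint:
  fixes f g :: "'a::euclidean_space \<Rightarrow> 'a"
  assumes "geometric f" "geometric g" and adj: "\<And>x y. f x \<bullet> y = x \<bullet> g y"
  shows "neumann f x \<bullet> y = x \<bullet> neumann g y"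
proof -
  have "(\<lambda>t. (f ^^ t) x \<bullet> y) sums (neumann f x \<bullet> y)"
    by (rule bounded_linear.sums[OF bounded_linear_inner_left neumann_sums[OF assms(1)]])
  moreover have "(\<lambda>t. x \<bullet> (g ^^ t) y) sums (x \<bullet> neumann g y)"
    by (rule bounded_linear.sums[OF bounded_linear_inner_right neumann_sums[OF assms(2)]])
  ultimately show ?thesis using sums_unique2 by (simp add: funpow_adjoint[OF adj]) blast
qed

section \<open>Mean-square stability\<close>

text \<open>The conditional expectation of V at the next mode, given that the current mode is
  i.\<close>

definition next_avg :: "('s::finite \<Rightarrow> 's \<Rightarrow> real) \<Rightarrow> (real^'n^'m)^'s \<Rightarrow> 's \<Rightarrow> real^'n^'m" where
  "next_avg p V i = (\<Sum>j\<in>UNIV. p i j *\<^sub>R V $ j)"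

text \<open>The backward operator on cost-to-go matrices; \<open>T_op\<close> propagates second
  moments forward.\<close>

definition T_adj :: "('s::finite \<Rightarrow> 's \<Rightarrow> real) \<Rightarrow> (real^'d^'d)^'s \<Rightarrow> (real^'d^'d)^'s \<Rightarrow> (real^'d^'d)^'s" where
  "T_adj p G V = (\<chi> i. transpose (G $ i) ** next_avg p V i ** G $ i)"

lemma next_avg_form:
  "x \<bullet> (next_avg p V i *v y) = (\<Sum>j\<in>UNIV. p i j * (x \<bullet> (V $ j *v y)))"
  by (simp add: next_avg_def sum_matrix_vector_mult inner_sum_right scaleR_matrix_vector_assoc[symmetric])

lemma next_avg_add: "next_avg p (V + W) i = next_avg p V i + next_avg p W i"
  by (simp add: next_avg_def scaleR_add_right sum.distrib)

lemma next_avg_scaleR: "next_avg p (r *\<^sub>R V) i = r *\<^sub>R next_avg p V i"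
  by (simp add: next_avg_def scaleR_sum_right mult_ac)

lemma T_adj_form:
  "x \<bullet> (T_adj p G V $ i *v y) = (G $ i *v x) \<bullet> (next_avg p V i *v (G $ i *v y))"
  by (simp add: T_adj_def matrix_vector_mul_assoc[symmetric])

lemma linear_T_adj: "linear (T_adj p G)"
  by (rule linearI)
     (simp_all add: T_adj_def vec_eq_iff next_avg_add next_avg_scaleR matrix_add_ldistrib
       matrix_mult_add_left matrix_scaleR_left matrix_scaleR_right)

lemma linear_T_op: "linear (T_op p G)"
  by (rule linearI)
     (simp_all add: T_op_def vec_eq_iff matrix_add_ldistrib matrix_mult_add_left
       matrix_scaleR_left matrix_scaleR_right sum.distrib distrib_left sum_distrib_left mult_ac)

lemma inner_congruence:
  fixes M :: "real^'m^'m" and N :: "real^'n^'m"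
  shows "(transpose N ** M ** N) \<bullet> Y = M \<bullet> (N ** Y ** transpose N)"
proof -
  have "(transpose N ** (M ** N)) \<bullet> Y = (M ** N) \<bullet> (N ** Y)"
    using inner_matrix_mult_left[of "transpose N" "M ** N" Y] by simp
  then show ?thesis by (simp add: matrix_mul_assoc inner_matrix_mult_right)
qed

lemma T_adj_inner: "T_adj p G V \<bullet> X = V \<bullet> T_op p G X"
proof -
  have "T_adj p G V \<bullet> X = (\<Sum>i\<in>UNIV. \<Sum>j\<in>UNIV. p i j * ((transpose (G $ i) ** V $ j ** G $ i) \<bullet> X $ i))"
    unfolding inner_vec_def[of "T_adj p G V"]
    by (simp add: T_adj_def next_avg_def matrix_scaleR_left
        matrix_scaleR_right inner_sum_left
        bounded_bilinear.sum_left[OF bounded_bilinear_matrix_mult]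
        bounded_bilinear.sum_right[OF bounded_bilinear_matrix_mult])
  also have "\<dots> = (\<Sum>j\<in>UNIV. \<Sum>i\<in>UNIV. p i j * (V $ j \<bullet> (G $ i ** X $ i ** transpose (G $ i))))"
    by (subst sum.swap) (simp add: inner_congruence)
  also have "\<dots> = V \<bullet> T_op p G X"
    by (simp add: inner_vec_def[of V] T_op_def inner_sum_right)
  finally show ?thesis .
qed

section \<open>Expectations over mode paths\<close>

lemma sum_paths_Suc:
  "(\<Sum>w\<in>paths (Suc t). f w) = (\<Sum>w\<in>paths t. \<Sum>j\<in>(UNIV :: 's::finite set). f (w(Suc t := j)))"
proof -
  have "paths (Suc t) = (\<lambda>(y, g). g(Suc t := y)) ` ((UNIV :: 's set) \<times> paths t)"
    unfolding paths_def atMost_Suc by (rule PiE_insert_eq)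
  moreover have "inj_on (\<lambda>(y, g). g(Suc t := y)) ((UNIV :: 's set) \<times> paths t)"
    unfolding paths_def by (rule inj_combinator) simp
  ultimately have "(\<Sum>w\<in>paths (Suc t). f w) = (\<Sum>(j, w)\<in>UNIV \<times> paths t. f (w(Suc t := j)))"
    by (simp add: sum.reindex case_prod_unfold)
  also have "\<dots> = (\<Sum>j\<in>UNIV. \<Sum>w\<in>paths t. f (w(Suc t := j)))"
    by (simp add: sum.cartesian_product)
  finally show ?thesis by (subst sum.swap) 
qed

lemma sum_paths_0:
  "(\<Sum>w\<in>paths 0. f (w 0)) = (\<Sum>j\<in>(UNIV :: 's::finite set). f j)"
proof -
  have eq: "paths 0 = (\<lambda>(y, g). g(0 := y)) ` ((UNIV :: 's set) \<times> PiE {} (\<lambda>_. UNIV))"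
    unfolding paths_def using PiE_insert_eq[of "0::nat" "{}" "\<lambda>_. UNIV :: 's set"] by simp
  have "inj_on (\<lambda>(y, g). g(0 := y)) ((UNIV :: 's set) \<times> PiE {} (\<lambda>_ :: nat. UNIV))"
    by (rule inj_combinator) simp
  then have "(\<Sum>w\<in>paths 0. f (w 0)) = (\<Sum>(j, w)\<in>UNIV \<times> PiE {} (\<lambda>_ :: nat. UNIV :: 's set). f j)"
    unfolding eq by (simp add: sum.reindex case_prod_unfold)
  also have "\<dots> = (\<Sum>j\<in>UNIV. f j)"
    by (simp add: sum.cartesian_product[symmetric])
  finally show ?thesis .
qed

lemma trans_mat_cong:
  assumes "\<And>s. s < t \<Longrightarrow> w s = w' s"
  shows "trans_mat G w t = trans_mat G w' t"
  using assms by (induction t) auto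

lemma path_prob_extend:
  "path_prob \<pi> p (w(Suc t := j)) (Suc t) = path_prob \<pi> p w t * p (w t) j"
proof -
  have "(\<Prod>s<t. p ((w(Suc t := j)) s) ((w(Suc t := j)) (Suc s))) = (\<Prod>s<t. p (w s) (w (Suc s)))"
    by (intro prod.cong refl) auto
  then show ?thesis by (simp add: path_prob_def)
qed

text \<open>The induction must vary V: the transition matrix at time \<open>Suc t\<close> reads
  modes up to t only, so the last mode occurs in V alone, and summing it out replaces V by
  \<open>T_adj p G V\<close>. Adjointness then puts one more \<open>T_op\<close> on the other
  side.\<close>

lemma path_sum_eq_T_op:
  "(\<Sum>w\<in>paths t. path_prob \<pi> p w t *
      (V $ (w t) \<bullet> (trans_mat G w t ** S ** transpose (trans_mat G w t))))
   = V \<bullet> (T_op p G ^^ t) (\<chi> i. \<pi> i *\<^sub>R S)"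
proof (induction t arbitrary: V)
  case 0
  show ?case
    using sum_paths_0[of "\<lambda>j. \<pi> j * (V $ j \<bullet> S)"]
    by (simp add: path_prob_def inner_vec_def[of V])
next
  case (Suc t)
  let ?\<Phi> = "\<lambda>w. trans_mat G w t"
  have step: "(\<Sum>j\<in>UNIV. path_prob \<pi> p (w(Suc t := j)) (Suc t) * (V $ ((w(Suc t := j)) (Suc t)) \<bullet>
      (trans_mat G (w(Suc t := j)) (Suc t) ** S ** transpose (trans_mat G (w(Suc t := j)) (Suc t)))))
    = path_prob \<pi> p w t * (T_adj p G V $ (w t) \<bullet> (?\<Phi> w ** S ** transpose (?\<Phi> w)))" for w
  proof -
    have c: "trans_mat G (w(Suc t := j)) t = ?\<Phi> w" for j by (rule trans_mat_cong) auto
    let ?Y = "?\<Phi> w ** S ** transpose (?\<Phi> w)"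
    have e: "T_adj p G V $ (w t) \<bullet> ?Y = (\<Sum>j\<in>UNIV. p (w t) j * (V $ j \<bullet> (G $ w t ** ?Y ** transpose (G $ w t))))"
    proof -
      have "T_adj p G V $ (w t) \<bullet> ?Y = next_avg p V (w t) \<bullet> (G $ w t ** ?Y ** transpose (G $ w t))"
        unfolding T_adj_def vec_lambda_beta
        by (rule inner_congruence)
      then show ?thesis by (simp add: next_avg_def inner_sum_left)
    qed
    show ?thesis
      unfolding path_prob_extend e sum_distrib_left
      by (simp add: c matrix_transpose_mul matrix_mul_assoc mult_ac)
  qed
  show ?case
    unfolding sum_paths_Suc step Suc.IH by (simp add: T_adj_inner)
qed

lemma T_op_funpow_inner: "V \<bullet> (T_op p G ^^ t) X = (T_adj p G ^^ t) V \<bullet> X"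
  by (rule funpow_adjoint[symmetric]) (rule T_adj_inner)

text \<open>The second moment started at a fixed mode and state is a path sum with a point mass as
  initial distribution and x x^T as initial second moment. Moving the powers of \<open>T_op\<close>
  onto the identity tuple removes the paths.\<close>

lemma ms_stable_iff_tendsto:
  fixes G :: "(real^'d^'d)^'s::finite"
  shows "ms_stable p G \<longleftrightarrow>
    (\<forall>i x. (\<lambda>t. x \<bullet> ((T_adj p G ^^ t) (\<chi> i. mat 1) $ i *v x)) \<longlonglongrightarrow> 0)"
proof -
  have "(\<Sum>w\<in>paths t. (if w 0 = i then (\<Prod>s<t. p (w s) (w (Suc s))) else 0)
            * (norm (trans_mat G w t *v x))\<^sup>2)
      = x \<bullet> ((T_adj p G ^^ t) (\<chi> i. mat 1) $ i *v x)" (is "?l = _") for i x t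
  proof -
    let ?\<pi> = "\<lambda>j. if j = i then 1 else 0 :: real"
    have "?l = (\<Sum>w\<in>paths t. path_prob ?\<pi> p w t * ((\<chi> i. mat 1) $ (w t) \<bullet>
        (trans_mat G w t ** outer x x ** transpose (trans_mat G w t))))"
      by (intro sum.cong refl) (simp add: path_prob_def matrix_mult_outer power2_norm_eq_inner)
    also have "\<dots> = (T_adj p G ^^ t) (\<chi> i. mat 1) \<bullet> (\<chi> j. ?\<pi> j *\<^sub>R outer x x)"
      unfolding path_sum_eq_T_op T_op_funpow_inner by (rule refl)
    also have "\<dots> = (\<Sum>j\<in>UNIV. if j = i then x \<bullet> ((T_adj p G ^^ t) (\<chi> i. mat 1) $ j *v x) else 0)"
      unfolding inner_vec_def[of "(T_adj p G ^^ t) (\<chi> i. mat 1)"]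
      by (intro sum.cong refl) simp
    finally show ?thesis by simp
  qed
  then show ?thesis unfolding ms_stable_def by simp
qed

text \<open>A substitute for \<open>- W \<le> V \<le> W\<close> that does not require \<open>V\<close> to be symmetric.\<close>

definition dominated :: "(real^'n^'n)^'s::finite \<Rightarrow> (real^'n^'n)^'s \<Rightarrow> bool" where
  "dominated V W \<longleftrightarrow>
     (\<forall>i x y. x \<bullet> (V $ i *v y) \<le> (x \<bullet> (W $ i *v x) + y \<bullet> (W $ i *v y)) / 2)"

definition psd_tuple :: "(real^'n^'n)^'s::finite \<Rightarrow> bool" where
  "psd_tuple V \<longleftrightarrow> (\<forall>i. psd (V $ i))"

lemma psd_iff: "psd M \<longleftrightarrow> (\<forall>x y. x \<bullet> (M *v y) = y \<bullet> (M *v x)) \<and> (\<forall>x. 0 \<le> x \<bullet> (M *v x))"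
proof -
  have "transpose M = M" if "\<forall>x y. x \<bullet> (M *v y) = y \<bullet> (M *v x)"
  proof (rule matrix_eqI_inner)
    fix x y
    show "x \<bullet> (transpose M *v y) = x \<bullet> (M *v y)"
      using that by (metis inner_commute inner_transpose_matrix_vector)
  qed
  then show ?thesis unfolding psd_def using inner_matrix_vector_sym by blast
qed

lemma psd_inner_mono_tuple:
  assumes "psd_tuple X" and "\<And>i x. x \<bullet> (V $ i *v x) \<le> x \<bullet> (W $ i *v x)"
  shows "V \<bullet> X \<le> W \<bullet> X"
  using assms unfolding inner_vec_def[of V] inner_vec_def[of W] psd_tuple_def
  by (intro sum_mono psd_inner_mono) auto

lemma psd_sum: "(\<And>j. j \<in> S \<Longrightarrow> psd (f j)) \<Longrightarrow> psd (\<Sum>j\<in>S. f j)"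
  unfolding psd_iff by (simp add: sum_matrix_vector_mult inner_sum_right sum_nonneg) 

lemma psd_scaleR: "0 \<le> r \<Longrightarrow> psd M \<Longrightarrow> psd (r *\<^sub>R M)"
  unfolding psd_iff by (simp add: scaleR_matrix_vector_assoc[symmetric])

lemma psd_congruence: "psd M \<Longrightarrow> psd (transpose N ** M ** N)"
  unfolding psd_iff by (simp add: matrix_vector_mul_assoc[symmetric])

lemma psd_next_avg:
  assumes "\<And>i j. 0 \<le> p i j" and "psd_tuple V"
  shows "psd (next_avg p V i)"
  unfolding next_avg_def using assms by (intro psd_sum psd_scaleR) (auto simp: psd_tuple_def)

lemma psd_T_adj:
  assumes "\<And>i j. 0 \<le> p i j" and "psd_tuple V"
  shows "psd_tuple (T_adj p G V)"
  unfolding psd_tuple_def T_adj_def using psd_next_avg[OF assms] by (simp add: psd_congruence)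

lemma psd_T_op:
  assumes "\<And>i j. 0 \<le> p i j" and "psd_tuple V"
  shows "psd_tuple (T_op p G V)"
proof -
  have "psd (G $ i ** V $ i ** transpose (G $ i))" for i
    using psd_congruence[of "V $ i" "transpose (G $ i)"] assms(2) by (simp add: psd_tuple_def)
  then show ?thesis
    unfolding psd_tuple_def T_op_def by (auto intro!: psd_sum psd_scaleR assms(1))
qed

lemma psd_funpow:
  fixes f :: "(real^'n^'n)^'s::finite \<Rightarrow> (real^'n^'n)^'s"
  assumes "\<And>V. psd_tuple V \<Longrightarrow> psd_tuple (f V)" and "psd_tuple V"
  shows "psd_tuple ((f ^^ t) V)"
  by (induction t) (auto intro: assms)

lemma bounded_linear_form: "bounded_linear (\<lambda>V. x \<bullet> (V $ i *v y))"
  for x :: "real^'n" and y :: "real^'m"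
  using bounded_linear_compose[OF bounded_linear_inner_left[of "outer x y"] bounded_linear_vec_nth[of i]]
  by simp

lemma neumann_form_sums:
  fixes f :: "(real^'n^'m)^'s \<Rightarrow> (real^'n^'m)^'s::finite"
  assumes "geometric f"
  shows "(\<lambda>t. x \<bullet> ((f ^^ t) V $ i *v y)) sums (x \<bullet> (neumann f V $ i *v y))"
  by (rule bounded_linear.sums[OF bounded_linear_form neumann_sums[OF assms]])

lemma psd_neumann:
  fixes f :: "(real^'n^'n)^'s::finite \<Rightarrow> (real^'n^'n)^'s"
  assumes "geometric f" and "\<And>V. psd_tuple V \<Longrightarrow> psd_tuple (f V)" and "psd_tuple V"
  shows "psd_tuple (neumann f V)"
  unfolding psd_tuple_def psd_iff
proof (intro allI conjI)
  fix i x y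
  have V: "psd ((f ^^ t) V $ i)" for t
    using psd_funpow[of f V t] assms(2,3) by (auto simp: psd_tuple_def)
  show "x \<bullet> (neumann f V $ i *v y) = y \<bullet> (neumann f V $ i *v x)"
    using neumann_form_sums[OF assms(1), of x V i y] neumann_form_sums[OF assms(1), of y V i x]
      V sums_unique2 unfolding psd_iff by simp
  show "0 \<le> x \<bullet> (neumann f V $ i *v x)"
    by (rule sums_le[OF _ sums_zero neumann_form_sums[OF assms(1)]])
       (use V in \<open>simp add: psd_iff\<close>)
qed

lemma dominated_T_adj:
  assumes p: "\<And>i j. 0 \<le> p i j" and "dominated V W"
  shows "dominated (T_adj p G V) (T_adj p G W)"
  unfolding dominated_def
proof (intro allI)
  fix i x y
  let ?x = "G $ i *v x" and ?y = "G $ i *v y"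
  have "(\<Sum>j\<in>UNIV. p i j * (?x \<bullet> (V $ j *v ?y)))
      \<le> (\<Sum>j\<in>UNIV. p i j * ((?x \<bullet> (W $ j *v ?x) + ?y \<bullet> (W $ j *v ?y)) / 2))"
    using assms unfolding dominated_def by (intro sum_mono mult_left_mono) auto
  also have "\<dots> = ((\<Sum>j\<in>UNIV. p i j * (?x \<bullet> (W $ j *v ?x))) + (\<Sum>j\<in>UNIV. p i j * (?y \<bullet> (W $ j *v ?y)))) / 2"
    by (simp add: sum.distrib[symmetric] sum_divide_distrib distrib_left)
  finally show "x \<bullet> (T_adj p G V $ i *v y)
      \<le> (x \<bullet> (T_adj p G W $ i *v x) + y \<bullet> (T_adj p G W $ i *v y)) / 2"
    by (simp add: T_adj_form next_avg_form)
qed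

lemma dominated_funpow_T_adj:
  assumes "\<And>i j. 0 \<le> p i j" and "dominated V W"
  shows "dominated ((T_adj p G ^^ t) V) ((T_adj p G ^^ t) W)"
  by (induction t) (auto intro: assms dominated_T_adj)

text \<open>A comparison principle for Lyapunov equations: bounds on the sources pass to the
  solutions, because \<open>T_adj\<close> preserves the order.\<close>

lemma dominated_neumann:
  assumes "\<And>i j. 0 \<le> p i j" and "geometric (T_adj p G)" and "dominated V W"
  shows "dominated (neumann (T_adj p G) V) (neumann (T_adj p G) W)"
  unfolding dominated_def
proof (intro allI)
  fix i x y
  let ?f = "\<lambda>t. (T_adj p G ^^ t)"
  have "(\<lambda>t. (x \<bullet> (?f t W $ i *v x) + y \<bullet> (?f t W $ i *v y)) / 2) sums
      ((x \<bullet> (neumann (T_adj p G) W $ i *v x) + y \<bullet> (neumann (T_adj p G) W $ i *v y)) / 2)"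
    by (intro sums_divide sums_add neumann_form_sums assms(2))
  then show "x \<bullet> (neumann (T_adj p G) V $ i *v y)
      \<le> (x \<bullet> (neumann (T_adj p G) W $ i *v x) + y \<bullet> (neumann (T_adj p G) W $ i *v y)) / 2"
    using dominated_funpow_T_adj[of p V W _ G] assms(1,3) unfolding dominated_def
    by (intro sums_le[OF _ neumann_form_sums[OF assms(2)]]) auto
qed

lemma dominated_mono:
  assumes "dominated V W" and "\<And>i x. x \<bullet> (W $ i *v x) \<le> x \<bullet> (W' $ i *v x)"
  shows "dominated V W'"
  unfolding dominated_def
proof (intro allI)
  fix i x y
  show "x \<bullet> (V $ i *v y) \<le> (x \<bullet> (W' $ i *v x) + y \<bullet> (W' $ i *v y)) / 2"
    using assms(1)[unfolded dominated_def, rule_format, of x i y] assms(2)[of x i] assms(2)[of y i]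
    by simp
qed

section \<open>Lyapunov functions and geometric decay\<close>

lemma norm_tuple_le_entries:
  fixes V :: "(real^'n^'m)^'s::finite"
  shows "norm V \<le> (\<Sum>i\<in>UNIV. \<Sum>a\<in>UNIV. \<Sum>b\<in>UNIV. \<bar>V $ i $ a $ b\<bar>)"
proof -
  have "norm V \<le> (\<Sum>i\<in>UNIV. norm (V $ i))"
    unfolding norm_vec_def[of V] by (rule L2_set_le_sum) simp
  also have "\<dots> \<le> (\<Sum>i\<in>UNIV. \<Sum>a\<in>UNIV. norm (V $ i $ a))"
    by (rule sum_mono) (unfold norm_vec_def[of "V $ _"], rule L2_set_le_sum, simp)
  also have "\<dots> \<le> (\<Sum>i\<in>UNIV. \<Sum>a\<in>UNIV. \<Sum>b\<in>UNIV. \<bar>V $ i $ a $ b\<bar>)"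
    by (intro sum_mono norm_le_l1_cart)
  finally show ?thesis .
qed

text \<open>Entrywise and crude: the dimension factor only enters the prefactor of a geometric
  bound, not its ratio. Testing with a coordinate vector and its negative bounds the absolute value
  of an entry.\<close>

lemma dominated_imp_norm_le:
  fixes V :: "(real^'n^'n)^'s::finite"
  assumes "dominated V W" and W: "\<And>i x. x \<bullet> (W $ i *v x) \<le> \<kappa> * (x \<bullet> x)"
  shows "norm V \<le> real (CARD('s) * CARD('n) * CARD('n)) * \<kappa>"
proof -
  have b: "x \<bullet> (V $ i *v y) \<le> \<kappa>" if "norm x = 1" "norm y = 1" for x y i
    using assms(1)[unfolded dominated_def, rule_format, of x i y] W[of x i] W[of y i] that
    by (simp add: dot_square_norm)
  have "\<bar>V $ i $ a $ b\<bar> \<le> \<kappa>" for i a b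
  proof -
    have "V $ i $ a $ b = axis a 1 \<bullet> (V $ i *v axis b 1)"
      by (simp add: inner_axis' matrix_vector_mult_basis column_def)
    then show ?thesis
      using b[of "axis a 1" "axis b 1" i] b[of "- axis a 1" "axis b 1" i] by simp
  qed
  then have "norm V \<le> (\<Sum>i\<in>(UNIV::'s set). \<Sum>a\<in>(UNIV::'n set). \<Sum>b\<in>(UNIV::'n set). \<kappa>)"
    by (intro order_trans[OF norm_tuple_le_entries] sum_mono)
  then show ?thesis by simp
qed

lemma form_le_norm:
  fixes V :: "(real^'n^'m)^'s::finite"
  shows "x \<bullet> (V $ i *v y) \<le> norm V * norm x * norm y"
proof -
  have "x \<bullet> (V $ i *v y) \<le> norm x * norm (V $ i *v y)" by (rule norm_cauchy_schwarz)
  also have "\<dots> \<le> norm x * (norm V * norm y)"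
    by (intro mult_left_mono order_trans[OF norm_matrix_vector_le] mult_right_mono Finite_Cartesian_Product.norm_nth_le) auto
  finally show ?thesis by (simp add: mult_ac)
qed

text \<open>Any V is dominated by |V|/m times P, as P is at least m. \<open>T_adj\<close> preserves
  domination and shrinks P by \<rho>, so after t steps the dominating multiple carries the factor
  \<rho>^t.\<close>

lemma lyapunov_imp_geometric:
  fixes P :: "(real^'d^'d)^'s::finite"
  assumes p: "\<And>i j. 0 \<le> p i j" and m: "0 < m" "\<And>i x. m * (x \<bullet> x) \<le> x \<bullet> (P $ i *v x)"
    and \<rho>: "0 \<le> \<rho>" "\<rho> < 1" "\<And>i x. x \<bullet> (T_adj p G P $ i *v x) \<le> \<rho> * (x \<bullet> (P $ i *v x))"
  shows "geometric (T_adj p G)"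
proof -
  have bl: "bounded_linear (T_adj p G)"
    using linear_T_adj linear_conv_bounded_linear by blast
  have dom: "dominated ((T_adj p G ^^ t) V) ((norm V / m * \<rho> ^ t) *\<^sub>R P)" for t V
  proof (induction t)
    case 0
    show ?case unfolding dominated_def
    proof (intro allI)
      fix i x y
      have "x \<bullet> (V $ i *v y) \<le> norm V * (norm x * norm y)"
        using form_le_norm[of x V i y] by (simp add: mult_ac)
      also have "\<dots> \<le> norm V * ((x \<bullet> x + y \<bullet> y) / 2)"
        using sum_squares_bound[of "norm x" "norm y"]
        by (intro mult_left_mono) (auto simp: dot_square_norm)
      also have "\<dots> = norm V / m * ((m * (x \<bullet> x) + m * (y \<bullet> y)) / 2)"
        using m(1) by (simp add: field_simps)
      also have "\<dots> \<le> norm V / m * ((x \<bullet> (P $ i *v x) + y \<bullet> (P $ i *v y)) / 2)"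
        using m by (intro mult_left_mono divide_right_mono add_mono) auto
      finally show "x \<bullet> ((T_adj p G ^^ 0) V $ i *v y)
          \<le> (x \<bullet> (((norm V / m * \<rho> ^ 0) *\<^sub>R P) $ i *v x) + y \<bullet> (((norm V / m * \<rho> ^ 0) *\<^sub>R P) $ i *v y)) / 2"
        by (simp add: scaleR_matrix_vector_assoc[symmetric] add_divide_distrib distrib_left)
    qed
  next
    case (Suc t)
    let ?k = "norm V / m * \<rho> ^ t"
    have "dominated ((T_adj p G ^^ Suc t) V) (T_adj p G (?k *\<^sub>R P))"
      using dominated_T_adj[OF p Suc] by simp
    then show ?case
    proof (rule dominated_mono)
      fix i x
      have "0 \<le> ?k" using m \<rho> by simp
      then have "?k * (x \<bullet> (T_adj p G P $ i *v x)) \<le> ?k * (\<rho> * (x \<bullet> (P $ i *v x)))"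
        by (intro mult_left_mono \<rho>(3))
      then show "x \<bullet> (T_adj p G (?k *\<^sub>R P) $ i *v x) \<le> x \<bullet> (((norm V / m * \<rho> ^ Suc t) *\<^sub>R P) $ i *v x)"
        by (simp add: linear_cmul[OF linear_T_adj] scaleR_matrix_vector_assoc[symmetric] mult_ac)
    qed
  qed
  let ?c = "real (CARD('s) * CARD('d) * CARD('d)) * (norm P / m)"
  have "norm ((T_adj p G ^^ t) V) \<le> ?c * \<rho> ^ t * norm V" for t V
  proof -
    have "x \<bullet> (((norm V / m * \<rho> ^ t) *\<^sub>R P) $ i *v x) \<le> norm V / m * \<rho> ^ t * norm P * (x \<bullet> x)" for i x
    proof -
      have "x \<bullet> (P $ i *v x) \<le> norm P * (x \<bullet> x)"
        using form_le_norm[of x P i x] by (simp add: dot_square_norm power2_eq_square mult_ac)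
      then have "norm V / m * \<rho> ^ t * (x \<bullet> (P $ i *v x)) \<le> norm V / m * \<rho> ^ t * (norm P * (x \<bullet> x))"
        using m \<rho> by (intro mult_left_mono) auto
      then show ?thesis by (simp add: scaleR_matrix_vector_assoc[symmetric] mult_ac)
    qed
    from dominated_imp_norm_le[OF dom this] show ?thesis by (simp add: mult_ac)
  qed
  then show ?thesis using bl \<rho>(1,2) unfolding geometric_def by blast
qed

text \<open>A converse Lyapunov theorem. Choose N such that T^(N+1) I is at most I/2; then the
  finite sum P of T^t I over t up to N telescopes to T P = P + T^(N+1) I - I, which is at most P -
  I/2 and hence at most a fixed fraction of P.\<close>

lemma ms_stable_imp_geometric:
  fixes G :: "(real^'d^'d)^'s::finite"
  assumes p: "\<And>i j. 0 \<le> p i j" and "ms_stable p G"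
  shows "geometric (T_adj p G)"
proof -
  let ?I = "\<chi> i. mat 1 :: (real^'d^'d)^'s" and ?T = "T_adj p G"
  let ?tr = "\<lambda>t i. mat 1 \<bullet> ((?T ^^ t) ?I $ i)"
  have psd: "psd ((?T ^^ t) ?I $ i)" for t i
  proof -
    have "psd_tuple ((?T ^^ t) ?I)"
    proof (rule psd_funpow)
      show "psd_tuple ?I" by (simp add: psd_tuple_def psd_iff inner_commute)
    qed (rule psd_T_adj, use p in auto)
    then show ?thesis by (simp add: psd_tuple_def)
  qed
  have "(\<lambda>t. ?tr t i) \<longlonglongrightarrow> 0" for i
  proof -
    have "mat 1 \<bullet> M = (\<Sum>a\<in>UNIV. axis a 1 \<bullet> (M *v axis a 1))" for M :: "real^'d^'d"
      using trace_matrix_mult_inner[of "mat 1" M]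
      by (simp add: trace_def inner_axis' matrix_vector_mult_basis column_def)
    then show ?thesis using assms(2) by (auto simp: ms_stable_iff_tendsto intro!: tendsto_null_sum)
  qed
  then have "(\<lambda>t. \<Sum>i\<in>UNIV. ?tr t i) \<longlonglongrightarrow> 0" by (intro tendsto_null_sum)
  then have "eventually (\<lambda>t. (\<Sum>i\<in>UNIV. ?tr t i) < 1/2) sequentially"
    by (rule order_tendstoD) simp
  \<comment> \<open>Taking a successor as exponent guarantees that the sum defining P contains the
    term at t = 0, so that P is at least I.\<close>
  then obtain N where N: "(\<Sum>i\<in>UNIV. ?tr (Suc N) i) < 1/2"
    unfolding eventually_sequentially by (meson le_SucI order_refl)
  have nn: "0 \<le> ?tr t i" for t i
    using psd_inner_mono[OF psd[of t i], of 0 "mat 1"] by simp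
  have N': "x \<bullet> ((?T ^^ Suc N) ?I $ i *v x) \<le> (x \<bullet> x) / 2" for i x
  proof -
    have "?tr (Suc N) i \<le> (\<Sum>i\<in>UNIV. ?tr (Suc N) i)" by (rule member_le_sum) (simp_all del: funpow.simps add: nn)
    then have "?tr (Suc N) i * (x \<bullet> x) \<le> 1/2 * (x \<bullet> x)" using N by (intro mult_right_mono) auto
    then show ?thesis using psd_form_le_trace[OF psd, of x "Suc N" i] by simp
  qed
  define P where "P = (\<Sum>t<Suc N. (?T ^^ t) ?I)"
  have P_form: "x \<bullet> (P $ i *v x) = (\<Sum>t<Suc N. x \<bullet> ((?T ^^ t) ?I $ i *v x))" for i x
    by (simp add: P_def sum_matrix_vector_mult inner_sum_right matrix_vector_mult_add_rdistrib inner_add_right)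
  have P_ge: "1 * (x \<bullet> x) \<le> x \<bullet> (P $ i *v x)" for i x
  proof -
    have "x \<bullet> ((?T ^^ 0) ?I $ i *v x) \<le> (\<Sum>t<Suc N. x \<bullet> ((?T ^^ t) ?I $ i *v x))"
      using psd unfolding psd_iff by (intro member_le_sum) auto
    then show ?thesis by (simp add: P_form)
  qed
  have "?T P = (\<Sum>t<Suc N. (?T ^^ Suc t) ?I)"
    unfolding P_def by (simp add: linear_sum[OF linear_T_adj] linear_add[OF linear_T_adj])
  also have "\<dots> = P + (?T ^^ Suc N) ?I - ?I"
    unfolding P_def using sum.lessThan_Suc_shift[of "\<lambda>t. (?T ^^ t) ?I" "Suc N"]
    by (simp add: algebra_simps)
  finally have TP: "?T P = P + (?T ^^ Suc N) ?I - ?I" .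
  define M where "M = norm P + 1"
  have M: "M > 0" "1 \<le> M" unfolding M_def by (auto simp: add_nonneg_pos)
  have P_le: "x \<bullet> (P $ i *v x) \<le> M * (x \<bullet> x)" for i x
    using form_le_norm[of x P i x] by (simp add: M_def dot_square_norm power2_eq_square algebra_simps
        add_increasing)
  show ?thesis
  proof (rule lyapunov_imp_geometric[OF p _ P_ge])
    show "0 \<le> 1 - 1 / (2 * M)" "1 - 1 / (2 * M) < 1" using M by (auto simp: field_simps)
    fix i x
    have "x \<bullet> (?T P $ i *v x) \<le> x \<bullet> (P $ i *v x) - (x \<bullet> x) / 2"
      using N'[of x i] unfolding TP
      by (simp add: matrix_vector_mult_add_rdistrib matrix_vector_mult_diff_rdistrib inner_add_right inner_diff_right)
    also have "\<dots> \<le> (1 - 1 / (2 * M)) * (x \<bullet> (P $ i *v x))"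
      using P_le[of x i] M(1) by (simp add: field_simps)
    finally show "x \<bullet> (?T P $ i *v x) \<le> (1 - 1 / (2 * M)) * (x \<bullet> (P $ i *v x))" .
  qed simp
qed

lemma geometric_imp_ms_stable:
  assumes "geometric (T_adj p G)"
  shows "ms_stable p G"
  unfolding ms_stable_iff_tendsto
proof (intro allI)
  fix i x
  show "(\<lambda>t. x \<bullet> ((T_adj p G ^^ t) (\<chi> i. mat 1) $ i *v x)) \<longlonglongrightarrow> 0"
    using neumann_form_sums[OF assms] sums_summable summable_LIMSEQ_zero by blast
qed

lemma ms_stable_iff_geometric:
  assumes "\<And>i j. 0 \<le> p i j"
  shows "ms_stable p G \<longleftrightarrow> geometric (T_adj p G)"
  using ms_stable_imp_geometric[of p G] geometric_imp_ms_stable assms by blast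

lemma geometric_T_op: "geometric (T_adj p G) \<Longrightarrow> geometric (T_op p G)"
  by (rule geometric_adjoint[OF _ T_adj_inner])
     (auto simp: linear_T_op linear_conv_bounded_linear[symmetric])

section \<open>Perturbation of fixed points\<close>

lemma has_vector_derivative_caratheodory:
  fixes f :: "real \<Rightarrow> 'a::real_normed_vector"
  shows "(f has_vector_derivative D) (at x) \<longleftrightarrow> ((\<lambda>y. (f y - f x) /\<^sub>R (y - x)) \<longlongrightarrow> D) (at x)"
proof -
  have "norm (f y - f x - (y - x) *\<^sub>R D) / norm (y - x) = norm ((f y - f x) /\<^sub>R (y - x) - D)"
    if "y \<noteq> x" for y
  proof -
    have "(f y - f x) /\<^sub>R (y - x) - D = (f y - f x - (y - x) *\<^sub>R D) /\<^sub>R (y - x)"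
      using that by (simp add: scaleR_diff_right)
    then show ?thesis by (simp add: divide_inverse mult.commute)
  qed
  then have "((\<lambda>y. norm (f y - f x - (y - x) *\<^sub>R D) / norm (y - x)) \<longlongrightarrow> 0) (at x)
      \<longleftrightarrow> ((\<lambda>y. norm ((f y - f x) /\<^sub>R (y - x) - D)) \<longlongrightarrow> 0) (at x)"
    by (intro filterlim_cong refl) (auto simp: eventually_at_filter)
  then show ?thesis
    unfolding has_vector_derivative_def has_derivative_iff_norm
    by (auto simp: tendsto_norm_zero_iff LIM_zero_iff intro: bounded_linear_scaleR_left)
qed

text \<open>Caratheodory's criterion. The cost admits such a factorization exactly, with a factor
  that varies with K' only through X and K' itself, so differentiability reduces to continuity of
  X.\<close>

lemma gderiv_factorization:
  fixes f :: "'a::real_inner \<Rightarrow> real"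
  assumes "eventually (\<lambda>y. f y - f x = (y - x) \<bullet> D y) (at x)" and "(D \<longlongrightarrow> D0) (at x)"
  shows "GDERIV f x :> D0"
  unfolding gderiv_def has_derivative_iff_norm
proof
  show "bounded_linear (\<lambda>h. h \<bullet> D0)" by (rule bounded_linear_inner_left)
  show "((\<lambda>y. norm (f y - f x - (y - x) \<bullet> D0) / norm (y - x)) \<longlongrightarrow> 0) (at x)"
  proof (rule Lim_null_comparison)
    show "((\<lambda>y. norm (D y - D0)) \<longlongrightarrow> 0) (at x)"
      using assms(2) by (simp add: tendsto_norm_zero_iff LIM_zero_iff)
    show "eventually (\<lambda>y. norm (norm (f y - f x - (y - x) \<bullet> D0) / norm (y - x)) \<le> norm (D y - D0)) (at x)"
      using assms(1)
    proof eventually_elim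
      case (elim y)
      have "norm (f y - f x - (y - x) \<bullet> D0) = \<bar>(y - x) \<bullet> (D y - D0)\<bar>"
        by (simp add: elim inner_diff_right)
      also have "\<dots> \<le> norm (y - x) * norm (D y - D0)" by (rule Cauchy_Schwarz_ineq2)
      finally show ?case
        by (cases "y = x") (auto simp: divide_le_eq mult.commute)
    qed
  qed
qed

lemma grad_eqI:
  assumes "GDERIV f x :> D"
  shows "grad f x = D"
  unfolding grad_def
proof (rule the_equality)
  fix D' assume "GDERIV f x :> D'"
  then have "(\<lambda>h. h \<bullet> D') = (\<lambda>h. h \<bullet> D)"
    using assms unfolding gderiv_def by (rule has_derivative_unique)
  then show "D' = D" by (metis vector_eq_ldot)
qed (rule assms)

text \<open>The resolvent identity, with the change of operator applied to the perturbed solution,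
  so that only the unperturbed operator is inverted.\<close>

lemma fixpoint_difference:
  fixes T0 Tx :: "'b::euclidean_space \<Rightarrow> 'b"
  assumes "geometric T0" and "y0 = c0 + T0 y0" and "yx = cx + Tx yx"
  shows "yx - y0 = neumann T0 ((cx - c0) + (Tx yx - T0 yx))"
proof (rule neumann_unique[OF assms(1)])
  have "linear T0" using assms(1) geometric_bounded_linear bounded_linear.linear by blast
  then have "T0 (yx - y0) = T0 yx - T0 y0" by (rule linear_diff)
  moreover have "yx - y0 = (cx + Tx yx) - (c0 + T0 y0)"
    by (rule arg_cong2[where f = "(-)", OF assms(3,2)])
  ultimately show "yx - y0 = (cx - c0) + (Tx yx - T0 yx) + T0 (yx - y0)"
    by (simp only: add_diff_add diff_add_eq) (simp add: algebra_simps)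
qed

text \<open>The difference identity still contains the unknown \<open>y x\<close>. Its norm is split
  into |y0| plus the difference itself, and the latter part is absorbed on the left once g \<omega>
  is at most 1/2. Summing over a basis turns pointwise convergence of \<open>T x\<close> into the
  uniform modulus \<omega>.\<close>

lemma fixpoint_tendsto:
  fixes y c :: "'x \<Rightarrow> 'b::euclidean_space"
  assumes geo: "geometric T0" and y0: "y0 = c0 + T0 y0"
    and y: "eventually (\<lambda>x. y x = c x + T x (y x)) F"
    and lin: "\<And>x. linear (T x)"
    and c: "(c \<longlongrightarrow> c0) F" and T: "\<And>v. ((\<lambda>x. T x v) \<longlongrightarrow> T0 v) F"
  shows "(y \<longlongrightarrow> y0) F"
proof -
  obtain g where g: "0 < g" "\<And>v. norm (neumann T0 v) \<le> norm v * g"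
    using bounded_linear.pos_bounded[of "neumann T0"] linear_neumann[OF geo]
    by (auto simp: linear_conv_bounded_linear)
  define \<omega> where "\<omega> x = (\<Sum>b\<in>Basis. norm (T x b - T0 b))" for x
  have lin0: "linear T0" using geo geometric_bounded_linear bounded_linear.linear by blast
  have \<omega>: "norm (T x v - T0 v) \<le> \<omega> x * norm v" for x v
  proof -
    have rep: "L v = (\<Sum>b\<in>Basis. (v \<bullet> b) *\<^sub>R L b)" if "linear L" for L :: "'b \<Rightarrow> 'b"
    proof -
      have "L v = L (\<Sum>b\<in>Basis. (v \<bullet> b) *\<^sub>R b)" by (simp add: euclidean_representation)
      also have "\<dots> = (\<Sum>b\<in>Basis. (v \<bullet> b) *\<^sub>R L b)"
        using that by (simp add: linear_sum linear_cmul)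
      finally show ?thesis .
    qed
    have "T x v - T0 v = (\<Sum>b\<in>Basis. (v \<bullet> b) *\<^sub>R (T x b - T0 b))"
      unfolding rep[OF lin] rep[OF lin0] by (simp add: sum_subtractf scaleR_diff_right)
    also have "norm \<dots> \<le> (\<Sum>b\<in>Basis. norm v * norm (T x b - T0 b))"
      by (intro order_trans[OF norm_sum] sum_mono)
         (auto intro!: mult_right_mono Basis_le_norm)
    finally show ?thesis by (simp add: \<omega>_def sum_distrib_left mult.commute)
  qed
  have "((\<lambda>x. norm (T x b - T0 b)) \<longlongrightarrow> 0) F" for b
    using T[of b] by (simp add: tendsto_norm_zero_iff LIM_zero_iff)
  then have \<omega>0: "(\<omega> \<longlongrightarrow> 0) F" unfolding \<omega>_def by (intro tendsto_null_sum)
  then have small: "eventually (\<lambda>x. \<omega> x < 1 / (2 * g)) F"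
    using g(1) by (intro order_tendstoD) auto
  have "((\<lambda>x. 2 * g * (norm (c x - c0) + \<omega> x * norm y0)) \<longlongrightarrow> 2 * g * (norm (c0 - c0) + 0 * norm y0)) F"
    by (intro tendsto_intros c \<omega>0)
  then have lim: "((\<lambda>x. 2 * g * (norm (c x - c0) + \<omega> x * norm y0)) \<longlongrightarrow> 0) F" by simp
  have "eventually (\<lambda>x. norm (y x - y0) \<le> 2 * g * (norm (c x - c0) + \<omega> x * norm y0)) F"
    using small y
  proof eventually_elim
    case (elim x)
    let ?d = "norm (y x - y0)"
    have wn: "0 \<le> \<omega> x" unfolding \<omega>_def by (simp add: sum_nonneg)
    have "?d \<le> norm ((c x - c0) + (T x (y x) - T0 (y x))) * g"
      using g(2) fixpoint_difference[OF geo y0, of "y x" "c x" "T x"] elim(2) by simp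
    also have "\<dots> \<le> (norm (c x - c0) + \<omega> x * norm (y x)) * g"
      using g(1) \<omega>[of x "y x"] by (intro mult_right_mono order_trans[OF norm_triangle_ineq]) auto
    also have "\<dots> \<le> (norm (c x - c0) + \<omega> x * (norm y0 + ?d)) * g"
      using g(1) wn norm_triangle_sub[of "y x" y0]
      by (intro mult_right_mono add_left_mono mult_left_mono) auto
    finally have 1: "?d \<le> g * (norm (c x - c0) + \<omega> x * norm y0) + (g * \<omega> x) * ?d"
      by (simp add: algebra_simps)
    have "g * \<omega> x \<le> 1 / 2" using elim(1) g(1) by (simp add: field_simps)
    then have "(g * \<omega> x) * ?d \<le> 1 / 2 * ?d" by (intro mult_right_mono) auto
    with 1 show ?case by simp
  qed
  then have "((\<lambda>x. y x - y0) \<longlongrightarrow> 0) F" by (rule Lim_null_comparison[OF _ lim])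
  then show ?thesis by (simp add: LIM_zero_iff)
qed

text \<open>After division by r - s the difference identity is one fixed resolvent applied to an
  expression that converges, since y is already known to be continuous at s. The expansion of
  \<open>T r\<close> is exact because \<open>T_adj\<close> is quadratic in the gain.\<close>

lemma fixpoint_has_vector_derivative:
  fixes y c :: "real \<Rightarrow> 'b::euclidean_space"
  assumes geo: "geometric (T s)" and ys: "y s = c s + T s (y s)"
    and y: "eventually (\<lambda>r. y r = c r + T r (y r)) (at s)"
    and lin: "\<And>r. linear (T r)" "linear DT" "linear DDT"
    and c: "(c has_vector_derivative c') (at s)"
    and T: "\<And>r v. T r v = T s v + (r - s) *\<^sub>R DT v + (r - s)\<^sup>2 *\<^sub>R DDT v"
  shows "(y has_vector_derivative neumann (T s) (c' + DT (y s))) (at s)"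
proof -
  have tend: "((\<lambda>r. L (z r)) \<longlongrightarrow> L z0) (at s)"
    if "linear L" "(z \<longlongrightarrow> z0) (at s)" for L :: "'b \<Rightarrow> 'b" and z z0
    using that bounded_linear.tendsto linear_conv_bounded_linear by blast
  have c0: "(c \<longlongrightarrow> c s) (at s)"
    using has_vector_derivative_continuous[OF c] by (simp add: continuous_at)
  have T0: "((\<lambda>r. T r v) \<longlongrightarrow> T s v) (at s)" for v
  proof -
    have "((\<lambda>r. T s v + (r - s) *\<^sub>R DT v + (r - s)\<^sup>2 *\<^sub>R DDT v) \<longlongrightarrow>
        T s v + (s - s) *\<^sub>R DT v + (s - s)\<^sup>2 *\<^sub>R DDT v) (at s)"
      by (intro tendsto_intros)
    then show ?thesis by (subst T) simp
  qed
  have y0: "(y \<longlongrightarrow> y s) (at s)"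
    by (rule fixpoint_tendsto[OF geo ys y lin(1) c0 T0])
  have "((\<lambda>r. neumann (T s) ((c r - c s) /\<^sub>R (r - s) + DT (y r) + (r - s) *\<^sub>R DDT (y r)))
     \<longlongrightarrow> neumann (T s) (c' + DT (y s) + (s - s) *\<^sub>R DDT (y s))) (at s)"
    using c unfolding has_vector_derivative_caratheodory
    by (intro tend[OF linear_neumann[OF geo]] tendsto_add tendsto_scaleR tendsto_diff
        tendsto_ident_at tendsto_const tend[OF lin(2) y0] tend[OF lin(3) y0])
  moreover have "eventually (\<lambda>r. neumann (T s) ((c r - c s) /\<^sub>R (r - s) + DT (y r) + (r - s) *\<^sub>R DDT (y r))
      = (y r - y s) /\<^sub>R (r - s)) (at s)"
    using y eventually_neq_at_within[of s s UNIV]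
  proof eventually_elim
    case (elim r)
    have diff: "y r - y s = neumann (T s) ((c r - c s) + (T r (y r) - T s (y r)))"
      by (rule fixpoint_difference[OF geo ys]) (rule elim(1))
    have "(y r - y s) /\<^sub>R (r - s)
        = neumann (T s) (((c r - c s) + (T r (y r) - T s (y r))) /\<^sub>R (r - s))"
      unfolding diff
      by (rule linear_cmul[OF linear_neumann[OF geo], symmetric])
    also have "T r (y r) - T s (y r) = (r - s) *\<^sub>R (DT (y r) + (r - s) *\<^sub>R DDT (y r))"
      by (subst T) (simp add: scaleR_add_right power2_eq_square)
    also have "((c r - c s) + (r - s) *\<^sub>R (DT (y r) + (r - s) *\<^sub>R DDT (y r))) /\<^sub>R (r - s)
        = (c r - c s) /\<^sub>R (r - s) + DT (y r) + (r - s) *\<^sub>R DDT (y r)"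
      using elim(2) by (simp add: scaleR_add_right)
    finally show ?case by simp
  qed
  ultimately have "((\<lambda>r. (y r - y s) /\<^sub>R (r - s)) \<longlongrightarrow> neumann (T s) (c' + DT (y s) + (s - s) *\<^sub>R DDT (y s))) (at s)"
    by (rule Lim_transform_eventually)
  then show ?thesis unfolding has_vector_derivative_caratheodory by simp
qed

section \<open>Cost and coupled Lyapunov equations\<close>

locale mjls =
  fixes A :: "(real^'d::finite^'d)^'s::finite"
    and B :: "(real^'k::finite^'d)^'s"
    and Q :: "(real^'d^'d)^'s"
    and R :: "(real^'k^'k)^'s"
    and p :: "'s \<Rightarrow> 's \<Rightarrow> real"
    and \<pi> :: "'s \<Rightarrow> real"
    and Sigma0 :: "real^'d^'d"
  assumes p_nonneg: "\<And>i j. 0 \<le> p i j"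
    and p_stoch: "\<And>i. (\<Sum>j\<in>UNIV. p i j) = 1"
    and pi_pos: "\<And>i. 0 < \<pi> i"
    and Sigma0_pd: "pos_def Sigma0"
    and Q_pd: "\<And>i. pos_def (Q $ i)"
    and R_pd: "\<And>i. pos_def (R $ i)"
begin

abbreviation "\<Gamma> \<equiv> closed_loop A B"
abbreviation "\<K> \<equiv> stab_gains A B p"
abbreviation "C \<equiv> cost A B Q R p \<pi> Sigma0"
abbreviation "X \<equiv> XK A B p \<pi> Sigma0"
abbreviation "X0 \<equiv> (\<chi> i. \<pi> i *\<^sub>R Sigma0)"
abbreviation "T K \<equiv> T_adj p (\<Gamma> K)"
abbreviation "tr V \<equiv> (\<chi> i. mat 1) \<bullet> V"

definition stage :: "(real^'d^'k)^'s \<Rightarrow> (real^'d^'d)^'s" where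
  "stage K = (\<chi> i. Q $ i + transpose (K $ i) ** R $ i ** K $ i)"

text \<open>Junk unless \<open>K\<close> is stabilizing, as the series then need not converge.\<close>

definition P :: "(real^'d^'k)^'s \<Rightarrow> (real^'d^'d)^'s" where
  "P K = neumann (T K) (stage K)"

definition \<mu> :: real where
  "\<mu> = Min (range \<pi>) * sigma_min Sigma0"

lemma Gamma_mult: "\<Gamma> K $ i *v x = A $ i *v x - B $ i *v (K $ i *v x)"
  by (simp add: closed_loop_def matrix_vector_mult_diff_rdistrib matrix_vector_mul_assoc)

lemma stage_form: "x \<bullet> (stage K $ i *v y) = x \<bullet> (Q $ i *v y) + (K $ i *v x) \<bullet> (R $ i *v (K $ i *v y))"
  by (simp add: stage_def matrix_vector_mult_add_rdistrib inner_add_right matrix_vector_mul_assoc[symmetric])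

lemma psd_Q: "psd (Q $ i)" and psd_R: "psd (R $ i)"
  using Q_pd R_pd pos_def_imp_psd by auto

lemma psd_stage: "psd_tuple (stage K)"
  using psd_Q psd_R unfolding psd_tuple_def psd_iff by (simp add: stage_form)

lemma stab_iff: "K \<in> \<K> \<longleftrightarrow> geometric (T K)"
  by (simp add: stab_gains_def ms_stable_iff_geometric p_nonneg)

lemma X_eq: "X K = neumann (T_op p (\<Gamma> K)) X0"
  by (simp add: XK_def neumann_def)

lemma psd_X0: "psd_tuple X0"
  unfolding psd_tuple_def using pi_pos pos_def_imp_psd[OF Sigma0_pd] by (simp add: psd_scaleR less_imp_le)

lemma geometric_T_op_K: "K \<in> \<K> \<Longrightarrow> geometric (T_op p (\<Gamma> K))"
  by (simp add: stab_iff geometric_T_op)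

lemma psd_P: "K \<in> \<K> \<Longrightarrow> psd_tuple (P K)"
  unfolding P_def stab_iff by (rule psd_neumann[OF _ psd_T_adj psd_stage]) (auto intro: p_nonneg)

lemma psd_X: "K \<in> \<K> \<Longrightarrow> psd_tuple (X K)"
  unfolding X_eq by (rule psd_neumann[OF geometric_T_op_K psd_T_op psd_X0]) (auto intro: p_nonneg)

lemma P_fix: "K \<in> \<K> \<Longrightarrow> P K = stage K + T K (P K)"
  unfolding P_def stab_iff by (rule neumann_unfold)

lemma X_fix: "K \<in> \<K> \<Longrightarrow> X K = X0 + T_op p (\<Gamma> K) (X K)"
  unfolding X_eq by (rule neumann_unfold[OF geometric_T_op_K])

text \<open>A Lyapunov solution weighted by the initial second moment equals its source weighted by
  the accumulated second moment.\<close>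

lemma neumann_inner_X0: "K \<in> \<K> \<Longrightarrow> neumann (T K) V \<bullet> X0 = V \<bullet> X K"
  unfolding X_eq by (rule neumann_adjoint[OF _ geometric_T_op_K T_adj_inner]) (simp_all add: stab_iff)

lemma cost_eq_stage_X:
  assumes "K \<in> \<K>"
  shows "C K = stage K \<bullet> X K"
proof -
  have summand: "trace ((Q $ i + transpose (K $ i) ** R $ i ** K $ i) ** \<Phi> ** Sigma0 ** transpose \<Phi>)
      = stage K $ i \<bullet> (\<Phi> ** Sigma0 ** transpose \<Phi>)" for i \<Phi>
  proof -
    have "transpose (stage K $ i) = stage K $ i"
      using psd_stage unfolding psd_tuple_def psd_def by blast
    then show ?thesis
      using trace_matrix_mult_inner[of "stage K $ i" "\<Phi> ** Sigma0 ** transpose \<Phi>"]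
      by (simp add: stage_def matrix_mul_assoc)
  qed
  have "C K = (\<Sum>t. stage K \<bullet> (T_op p (\<Gamma> K) ^^ t) X0)"
    unfolding cost_def summand path_sum_eq_T_op by (rule refl)
  also have "\<dots> = stage K \<bullet> X K"
    unfolding X_eq
    by (rule sums_unique[symmetric])
       (rule bounded_linear.sums[OF bounded_linear_inner_right neumann_sums[OF geometric_T_op_K[OF assms]]])
  finally show ?thesis .
qed

lemma cost_eq_P_X0: "K \<in> \<K> \<Longrightarrow> C K = P K \<bullet> X0"
  by (simp add: cost_eq_stage_X P_def neumann_inner_X0)

lemma mu_pos: "0 < \<mu>"
  unfolding \<mu>_def using pi_pos pos_def_form_ge_sigma_min(2)[OF Sigma0_pd]
  by (intro mult_pos_pos) (auto simp: Min_gr_iff)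

lemma X0_ge: "\<mu> * (x \<bullet> x) \<le> x \<bullet> (X0 $ i *v x)"
proof -
  let ?s = "sigma_min Sigma0"
  have s: "0 < ?s" "?s * (x \<bullet> x) \<le> x \<bullet> (Sigma0 *v x)" using pos_def_form_ge_sigma_min[OF Sigma0_pd] by auto
  have "\<mu> * (x \<bullet> x) \<le> \<pi> i * (?s * (x \<bullet> x))"
    unfolding \<mu>_def mult.assoc using s(1) by (intro mult_right_mono Min_le) auto
  also have "\<dots> \<le> \<pi> i * (x \<bullet> (Sigma0 *v x))"
    using s(2) pi_pos[of i] by (intro mult_left_mono) auto
  finally show ?thesis by (simp add: scaleR_matrix_vector_assoc[symmetric])
qed

abbreviation "qmin \<equiv> Lambda_min Q"

lemma qmin_pos: "0 < qmin" by (rule Lambda_min_pos) (rule Q_pd)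

lemma Q_ge: "qmin * (x \<bullet> x) \<le> x \<bullet> (Q $ i *v x)" by (rule form_ge_Lambda_min) (rule Q_pd)

lemma P_form:
  assumes "K \<in> \<K>"
  shows "x \<bullet> (P K $ i *v x) = x \<bullet> (Q $ i *v x) + (K $ i *v x) \<bullet> (R $ i *v (K $ i *v x))
     + (\<Gamma> K $ i *v x) \<bullet> (next_avg p (P K) i *v (\<Gamma> K $ i *v x))"
  by (subst P_fix[OF assms])
     (simp add: matrix_vector_mult_add_rdistrib inner_add_right stage_form T_adj_form)

lemma psd_next_avg_P: "K \<in> \<K> \<Longrightarrow> psd (next_avg p (P K) i)"
  by (rule psd_next_avg) (auto intro: p_nonneg psd_P)

lemma P_ge_Q: "K \<in> \<K> \<Longrightarrow> x \<bullet> (Q $ i *v x) \<le> x \<bullet> (P K $ i *v x)"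
  using psd_next_avg_P psd_R by (auto simp: P_form psd_iff)

lemma X_ge_mu:
  assumes "K \<in> \<K>"
  shows "\<mu> * (x \<bullet> x) \<le> x \<bullet> (X K $ i *v x)"
proof -
  have "0 \<le> x \<bullet> (T_op p (\<Gamma> K) (X K) $ i *v x)"
    using psd_T_op[of p "X K" "\<Gamma> K"] p_nonneg psd_X[OF assms] unfolding psd_tuple_def psd_iff by blast
  then show ?thesis
    using X0_ge[of x i] by (subst X_fix[OF assms])
      (simp add: matrix_vector_mult_add_rdistrib inner_add_right)
qed

lemma psd_form_le_tr:
  assumes "psd_tuple V"
  shows "x \<bullet> (V $ i *v x) \<le> tr V * (x \<bullet> x)"
proof -
  have "0 \<le> mat 1 \<bullet> V $ j" for j
    using psd_inner_mono[of "V $ j" 0 "mat 1"] assms by (simp add: psd_tuple_def)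
  then have "mat 1 \<bullet> V $ i \<le> (\<Sum>j\<in>UNIV. mat 1 \<bullet> V $ j)" by (intro member_le_sum) auto
  also have "\<dots> = tr V" by (simp add: inner_vec_def[of "\<chi> i. mat 1"])
  finally have "(mat 1 \<bullet> V $ i) * (x \<bullet> x) \<le> tr V * (x \<bullet> x)" by (intro mult_right_mono) auto
  then show ?thesis using psd_form_le_trace[of "V $ i" x] assms unfolding psd_tuple_def by fastforce
qed

lemma tr_X_le:
  assumes "K \<in> \<K>"
  shows "qmin * tr (X K) \<le> C K"
proof -
  have "(qmin *\<^sub>R (\<chi> i. mat 1)) \<bullet> X K \<le> stage K \<bullet> X K"
  proof (rule psd_inner_mono_tuple[OF psd_X[OF assms]])
    fix i and x :: "real^'d"
    show "x \<bullet> ((qmin *\<^sub>R (\<chi> i. mat 1)) $ i *v x) \<le> x \<bullet> (stage K $ i *v x)"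
      using Q_ge[of x i] psd_R unfolding psd_iff
      by (simp add: stage_form scaleR_matrix_vector_assoc[symmetric] add_increasing2)
  qed
  then show ?thesis by (simp add: cost_eq_stage_X[OF assms])
qed

lemma P_le:
  assumes "K \<in> \<K>"
  shows "x \<bullet> (P K $ i *v x) \<le> C K / \<mu> * (x \<bullet> x)"
proof -
  have "(\<mu> *\<^sub>R (\<chi> i. mat 1)) \<bullet> P K \<le> X0 \<bullet> P K"
    using X0_ge by (intro psd_inner_mono_tuple[OF psd_P[OF assms]])
      (simp add: scaleR_matrix_vector_assoc[symmetric])
  then have "tr (P K) \<le> C K / \<mu>"
    using mu_pos by (simp add: cost_eq_P_X0[OF assms] inner_commute field_simps)
  then have "tr (P K) * (x \<bullet> x) \<le> C K / \<mu> * (x \<bullet> x)" by (intro mult_right_mono) auto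
  then show ?thesis using psd_form_le_tr[OF psd_P[OF assms], of x i] by linarith
qed

lemma next_avg_le:
  assumes "\<And>i x. x \<bullet> (V $ i *v x) \<le> c * (x \<bullet> x)"
  shows "x \<bullet> (next_avg p V i *v x) \<le> c * (x \<bullet> x)"
proof -
  have "(\<Sum>j\<in>UNIV. p i j * (x \<bullet> (V $ j *v x))) \<le> (\<Sum>j\<in>UNIV. p i j * (c * (x \<bullet> x)))"
    by (intro sum_mono mult_left_mono assms p_nonneg)
  also have "\<dots> = c * (x \<bullet> x)" by (simp add: sum_distrib_right[symmetric] p_stoch)
  finally show ?thesis by (simp add: next_avg_form)
qed

lemma cost_pos:
  assumes "K \<in> \<K>"
  shows "0 < C K"
proof -
  \<comment> \<open>\<open>undefined\<close> merely selects some coordinate and some mode; both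
    types are nonempty.\<close>
  have "\<mu> * (axis undefined 1 \<bullet> axis undefined (1::real)) \<le> tr (X K) * (axis undefined 1 \<bullet> axis undefined (1::real) :: real)"
    using X_ge_mu[OF assms, of "axis undefined 1" undefined]
      psd_form_le_tr[OF psd_X[OF assms], of "axis undefined 1" undefined] by (simp add: inner_axis)
  then have "0 < tr (X K)" using mu_pos by (simp add: inner_axis)
  then show ?thesis using tr_X_le[OF assms] qmin_pos by (meson mult_pos_pos less_le_trans)
qed

lemma norm_nth_matrix_le: "norm (U $ i *v x) \<le> norm U * norm x" for U :: "(real^'n^'m)^'s"
  by (meson Finite_Cartesian_Product.norm_nth_le mult_right_mono norm_ge_zero norm_matrix_vector_le order_trans)

text \<open>\<open>P K\<close> itself remains a Lyapunov function for the perturbed closed loop.\<close>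

lemma stab_gains_uniform_nbhd:
  assumes "0 < \<alpha>"
  shows "\<exists>\<delta>>0. \<forall>K K'. K \<in> \<K> \<longrightarrow> C K \<le> \<alpha> \<longrightarrow> norm (K' - K) < \<delta> \<longrightarrow> K' \<in> \<K>"
proof -
  \<comment> \<open>\<open>c\<close> bounds P on the sublevel set; adding \<open>qmin\<close>
    ensures that \<tau> below is at most 1/2.\<close>
  define c where "c = \<alpha> / \<mu> + qmin"
  have c: "0 < c" "qmin \<le> c" "\<alpha> / \<mu> \<le> c"
    unfolding c_def using assms mu_pos qmin_pos by (auto simp: add_nonneg_pos)
  \<comment> \<open>As 2 \<tau> c = qmin, subtracting Q from P leaves at most (1 - 2 \<tau>) P for
    the unperturbed closed loop. Young's inequality with weight \<tau> costs a factor 1 + \<tau>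
    there and 1 + 1/\<tau> on the perturbation; \<open>e\<close> and \<delta> are set so that the
    latter stays below (\<tau>/2) P. The total is 1 - \<tau>/2 - 2 \<tau>^2.\<close>
  define \<tau> where "\<tau> = qmin / (2 * c)"
  have \<tau>: "0 < \<tau>" "\<tau> \<le> 1/2" unfolding \<tau>_def using qmin_pos c by (auto simp: field_simps)
  define e where "e = (1 + 1 / \<tau>) * c * (max_norm B)\<^sup>2 / qmin"
  have e: "0 \<le> e" unfolding e_def using \<tau> c qmin_pos by simp
  define \<delta> where "\<delta> = min 1 (\<tau> / (2 * (e + 1)))"
  have \<delta>: "0 < \<delta>" "\<delta> \<le> 1" unfolding \<delta>_def using \<tau> e by auto
  have "e * \<delta> \<le> e * (\<tau> / (2 * (e + 1)))" using e unfolding \<delta>_def by (intro mult_left_mono) auto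
  also have "\<dots> \<le> \<tau> / 2" using e \<tau> by (simp add: field_simps)
  finally have e\<delta>: "e * \<delta> \<le> \<tau> / 2" .
  show ?thesis
  proof (intro exI conjI allI impI)
    show "0 < \<delta>" by (rule \<delta>(1))
    fix K K' assume K: "K \<in> \<K>" "C K \<le> \<alpha>" and close: "norm (K' - K) < \<delta>"
    have P_le_c: "x \<bullet> (P K $ i *v x) \<le> c * (x \<bullet> x)" for x i
    proof -
      have "C K / \<mu> * (x \<bullet> x) \<le> c * (x \<bullet> x)"
        using K(2) c(3) mu_pos by (intro mult_right_mono order_trans[OF _ c(3)] divide_right_mono) auto
      then show ?thesis using P_le[OF K(1), of x i] by linarith
    qed
    have "geometric (T K')"
    proof (rule lyapunov_imp_geometric)
      show "0 \<le> p i j" for i j by (rule p_nonneg)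
      show "0 < qmin" by (rule qmin_pos)
      show P_ge: "qmin * (x \<bullet> x) \<le> x \<bullet> (P K $ i *v x)" for i x
        using Q_ge[of x i] P_ge_Q[OF K(1), of x i] by linarith
      show "0 \<le> 1 - \<tau> / 2" "1 - \<tau> / 2 < 1" using \<tau> by auto
      fix i x
      let ?E = "next_avg p (P K) i" and ?q = "x \<bullet> (P K $ i *v x)"
      define g h where "g = \<Gamma> K $ i *v x" and "h = B $ i *v ((K' - K) $ i *v x)"
      have G': "\<Gamma> K' $ i *v x = g - h"
        by (simp add: g_def h_def Gamma_mult matrix_vector_mult_diff_rdistrib algebra_simps)
      have sym: "h \<bullet> (?E *v g) = g \<bullet> (?E *v h)"
        using psd_next_avg_P[OF K(1)] unfolding psd_iff by blast
      have "g \<bullet> (?E *v g) + x \<bullet> (Q $ i *v x) \<le> ?q"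
        using psd_R[of i] unfolding psd_iff by (simp add: P_form[OF K(1)] g_def)
      then have "g \<bullet> (?E *v g) \<le> ?q - qmin * (x \<bullet> x)" using Q_ge[of x i] by linarith
      also have "\<dots> \<le> (1 - 2 * \<tau>) * ?q"
      proof -
        have "2 * \<tau> * ?q \<le> 2 * \<tau> * (c * (x \<bullet> x))" using \<tau> P_le_c[of x i] by (intro mult_left_mono) auto
        also have "\<dots> = qmin * (x \<bullet> x)" unfolding \<tau>_def using c by simp
        finally show ?thesis by (simp add: algebra_simps)
      qed
      finally have gg: "g \<bullet> (?E *v g) \<le> (1 - 2 * \<tau>) * ?q" .
      have hh: "(1 + 1 / \<tau>) * (h \<bullet> (?E *v h)) \<le> \<tau> / 2 * ?q"
      proof -
        have "norm h \<le> max_norm B * (norm (K' - K) * norm x)"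
          unfolding h_def
          by (rule order_trans[OF norm_le_max_norm]) (intro mult_left_mono norm_nth_matrix_le max_norm_nonneg)
        also have "\<dots> \<le> max_norm B * (\<delta> * norm x)"
          using close by (intro mult_left_mono mult_right_mono max_norm_nonneg) auto
        finally have "h \<bullet> h \<le> (max_norm B * (\<delta> * norm x))\<^sup>2"
          unfolding dot_square_norm by (rule power_mono) simp
        also have "\<dots> = (max_norm B)\<^sup>2 * \<delta> * (x \<bullet> x) * \<delta>"
          by (simp add: power2_eq_square dot_square_norm mult_ac)
        also have "\<dots> \<le> (max_norm B)\<^sup>2 * \<delta> * (x \<bullet> x) * 1"
          using \<delta> by (intro mult_left_mono) auto
        finally have h2: "h \<bullet> h \<le> (max_norm B)\<^sup>2 * \<delta> * (x \<bullet> x)" by simp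
        have "h \<bullet> (?E *v h) \<le> c * (h \<bullet> h)" by (rule next_avg_le) (rule P_le_c)
        also have "\<dots> \<le> c * ((max_norm B)\<^sup>2 * \<delta> * (x \<bullet> x))" using h2 c by (intro mult_left_mono) auto
        finally have "(1 + 1 / \<tau>) * (h \<bullet> (?E *v h)) \<le> (1 + 1 / \<tau>) * (c * ((max_norm B)\<^sup>2 * \<delta> * (x \<bullet> x)))"
          using \<tau> by (intro mult_left_mono) auto
        also have "\<dots> = (e * \<delta>) * (qmin * (x \<bullet> x))" unfolding e_def using qmin_pos by simp
        also have "\<dots> \<le> \<tau> / 2 * ?q"
          using e\<delta> P_ge[of x i] \<tau> qmin_pos by (intro mult_mono) auto
        finally show ?thesis .
      qed
      have "0 \<le> (\<tau> *\<^sub>R g + h) \<bullet> (?E *v (\<tau> *\<^sub>R g + h))"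
        using psd_next_avg_P[OF K(1)] unfolding psd_iff by blast
      also have "\<dots> = \<tau>\<^sup>2 * (g \<bullet> (?E *v g)) + 2 * \<tau> * (g \<bullet> (?E *v h)) + h \<bullet> (?E *v h)"
        by (simp add: algebra_simps power2_eq_square sym)
      finally have "0 \<le> (\<tau>\<^sup>2 * (g \<bullet> (?E *v g)) + 2 * \<tau> * (g \<bullet> (?E *v h)) + h \<bullet> (?E *v h)) / \<tau>"
        using \<tau> by simp
      then have young: "- 2 * (g \<bullet> (?E *v h)) \<le> \<tau> * (g \<bullet> (?E *v g)) + h \<bullet> (?E *v h) / \<tau>"
        using \<tau> by (simp add: add_divide_distrib power2_eq_square)
      have "x \<bullet> (T_adj p (\<Gamma> K') (P K) $ i *v x)
          = g \<bullet> (?E *v g) - 2 * (g \<bullet> (?E *v h)) + h \<bullet> (?E *v h)"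
        unfolding T_adj_form G' by (simp add: algebra_simps sym)
      also have "\<dots> \<le> (1 + \<tau>) * (g \<bullet> (?E *v g)) + (1 + 1 / \<tau>) * (h \<bullet> (?E *v h))"
        using young by (simp add: algebra_simps)
      also have "\<dots> \<le> (1 + \<tau>) * ((1 - 2 * \<tau>) * ?q) + \<tau> / 2 * ?q"
        using gg hh \<tau> by (intro add_mono mult_left_mono) auto
      also have "\<dots> = (1 - \<tau> / 2) * ?q - 2 * \<tau>\<^sup>2 * ?q" by (simp add: algebra_simps power2_eq_square)
      also have "\<dots> \<le> (1 - \<tau> / 2) * ?q"
        using psd_P[OF K(1)] unfolding psd_tuple_def psd_iff by simp
      finally show "x \<bullet> (T_adj p (\<Gamma> K') (P K) $ i *v x) \<le> (1 - \<tau> / 2) * ?q" .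
    qed
    then show "K' \<in> \<K>" by (simp add: stab_iff)
  qed
qed

lemma open_stab_gains: "open \<K>"
  unfolding open_dist
proof
  fix K assume K: "K \<in> \<K>"
  obtain \<delta> where \<delta>: "\<delta> > 0"
    "\<And>K1 K'. \<lbrakk>K1 \<in> \<K>; C K1 \<le> C K; norm (K' - K1) < \<delta>\<rbrakk> \<Longrightarrow> K' \<in> \<K>"
    using stab_gains_uniform_nbhd[OF cost_pos[OF K]] by blast
  show "\<exists>e>0. \<forall>K'. dist K' K < e \<longrightarrow> K' \<in> \<K>"
    using \<delta>(1) \<delta>(2)[OF K order_refl] by (auto simp: dist_norm)
qed

lemma X_tendsto:
  assumes "K \<in> \<K>"
  shows "(X \<longlongrightarrow> X K) (at K)"
proof (rule fixpoint_tendsto[where T = "\<lambda>K'. T_op p (\<Gamma> K')"])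
  show "eventually (\<lambda>K'. X K' = X0 + T_op p (\<Gamma> K') (X K')) (at K)"
    using eventually_at_topological open_stab_gains assms X_fix by blast
  show "((\<lambda>K'. T_op p (\<Gamma> K') V) \<longlongrightarrow> T_op p (\<Gamma> K) V) (at K)" for V
    unfolding T_op_def closed_loop_def by (intro tendsto_intros)
qed (use assms in \<open>auto intro: geometric_T_op_K linear_T_op X_fix\<close>)

end

lemma tuple_eqI_form:
  fixes V W :: "(real^'n^'m)^'s"
  assumes "\<And>i x y. x \<bullet> (V $ i *v y) = x \<bullet> (W $ i *v y)"
  shows "V = W"
  using assms by (simp add: vec_eq_iff[of V] matrix_eqI_inner)

lemma minus_matrix_vector_mult: "(- N) *v y = - (N *v y)" for N :: "real^'n^'m"
  using matrix_vector_mult_diff_rdistrib[of 0 N y] by simp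

lemma inner_transpose_mult_sym:
  fixes D M :: "real^'n^'m" and S :: "real^'n^'n"
  assumes "transpose S = S"
  shows "(transpose D ** M) \<bullet> S = D \<bullet> (M ** S)"
proof -
  have "(transpose D ** M) \<bullet> S = M \<bullet> (D ** S)" using inner_matrix_mult_left[of "transpose D" M S] by simp
  also have "\<dots> = D \<bullet> (M ** S)" using inner_matrix_mult_right[of D S M] assms by (simp add: inner_commute)
  finally show ?thesis .
qed

text \<open>Rescaling x and y separately sharpens the arithmetic mean to a geometric one. The
  Hessian needs this form: there one argument carries a factor B, and the mixed term has to be
  linear in its norm.\<close>

lemma form_le_scale_invariant:
  fixes N :: "real^'n^'m"
  assumes "\<And>x y. x \<bullet> (N *v y) \<le> \<kappa> * ((x \<bullet> x + y \<bullet> y) / 2)"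
  shows "x \<bullet> (N *v y) \<le> \<kappa> * (norm x * norm y)"
proof (cases "x = 0 \<or> y = 0")
  case False
  have "(x /\<^sub>R norm x) \<bullet> (N *v (y /\<^sub>R norm y)) \<le> \<kappa>"
    using assms[of "x /\<^sub>R norm x" "y /\<^sub>R norm y"] False by (simp add: dot_square_norm field_simps)
  then have "x \<bullet> (N *v y) / (norm x * norm y) \<le> \<kappa>"
    by (simp add: matrix_vector_mult_scaleR divide_inverse mult_ac)
  then show ?thesis using False by (simp add: divide_le_eq)
qed auto

section \<open>Gradient\<close>

context mjls
begin

text \<open>Equal to H K - B^T E A, with E the averaged P and H as below: the residual of the
  stationarity condition for the optimal gain.\<close>

definition M :: "(real^'d^'k)^'s \<Rightarrow> (real^'d^'k)^'s" where
  "M K = (\<chi> i. R $ i ** K $ i - transpose (B $ i) ** next_avg p (P K) i ** \<Gamma> K $ i)"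

definition H :: "(real^'d^'k)^'s \<Rightarrow> (real^'k^'k)^'s" where
  "H K = (\<chi> i. R $ i + transpose (B $ i) ** next_avg p (P K) i ** B $ i)"

lemma M_form: "z \<bullet> (M K $ i *v x) =
    z \<bullet> (R $ i *v (K $ i *v x)) - (B $ i *v z) \<bullet> (next_avg p (P K) i *v (\<Gamma> K $ i *v x))"
  by (simp add: M_def matrix_vector_mult_diff_rdistrib inner_diff_right matrix_vector_mul_assoc[symmetric])

lemma H_form: "z \<bullet> (H K $ i *v x) =
    z \<bullet> (R $ i *v x) + (B $ i *v z) \<bullet> (next_avg p (P K) i *v (B $ i *v x))"
  by (simp add: H_def matrix_vector_mult_add_rdistrib inner_add_right matrix_vector_mul_assoc[symmetric])

text \<open>The excess cost of playing K + D for one step and K afterwards. The linear part is left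
  unsymmetrized, as the tuple is paired with symmetric matrices only.\<close>

definition cost_increment :: "(real^'d^'k)^'s \<Rightarrow> (real^'d^'k)^'s \<Rightarrow> (real^'d^'d)^'s" where
  "cost_increment K D =
     (\<chi> i. 2 *\<^sub>R (transpose (D $ i) ** M K $ i) + transpose (D $ i) ** (H K $ i ** D $ i))"

lemma cost_increment_form: "x \<bullet> (cost_increment K D $ i *v x) =
    2 * ((D $ i *v x) \<bullet> (M K $ i *v x)) + (D $ i *v x) \<bullet> (H K $ i *v (D $ i *v x))"
  by (simp add: cost_increment_def matrix_vector_mult_add_rdistrib inner_add_right
      scaleR_matrix_vector_assoc[symmetric] matrix_vector_mul_assoc[symmetric])

text \<open>The performance difference identity. The fixed-point equation of X at K' writes C K as
  (P K - T K' (P K)) paired with X at K', the same weight that C K' carries.\<close>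

lemma cost_diff:
  assumes K: "K \<in> \<K>" and K': "K' \<in> \<K>"
  shows "C K' - C K = cost_increment K (K' - K) \<bullet> X K'"
proof -
  let ?V = "stage K' + T K' (P K) - P K"
  have "C K = P K \<bullet> (X K' - T_op p (\<Gamma> K') (X K'))"
    using X_fix[OF K'] by (metis add_diff_cancel_right' cost_eq_P_X0[OF K])
  also have "\<dots> = (P K - T K' (P K)) \<bullet> X K'"
    by (simp add: inner_diff_right inner_diff_left T_adj_inner)
  finally have "C K' - C K = ?V \<bullet> X K'"
    by (simp add: cost_eq_stage_X[OF K'] inner_diff_left inner_add_left)
  moreover have "x \<bullet> (?V $ i *v x) = x \<bullet> (cost_increment K (K' - K) $ i *v x)" for i x
  proof -
    let ?E = "next_avg p (P K) i"
    define D where "D = (K' - K) $ i *v x"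
    let ?g = "\<Gamma> K $ i *v x" and ?h = "B $ i *v D" and ?k = "K $ i *v x"
    have G': "\<Gamma> K' $ i *v x = ?g - ?h" and K'x: "K' $ i *v x = ?k + D"
      by (simp_all add: D_def Gamma_mult matrix_vector_mult_diff_rdistrib algebra_simps)
    have sym: "?g \<bullet> (?E *v ?h) = ?h \<bullet> (?E *v ?g)" "?k \<bullet> (R $ i *v D) = D \<bullet> (R $ i *v ?k)"
      using psd_next_avg_P[OF K] psd_R unfolding psd_iff by blast+
    have "x \<bullet> (?V $ i *v x) = x \<bullet> (stage K' $ i *v x) + x \<bullet> (T K' (P K) $ i *v x) - x \<bullet> (P K $ i *v x)"
      by (simp add: matrix_vector_mult_diff_rdistrib matrix_vector_mult_add_rdistrib inner_diff_right inner_add_right)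
    also have "\<dots> = 2 * (D \<bullet> (R $ i *v ?k)) + D \<bullet> (R $ i *v D)
        - 2 * (?h \<bullet> (?E *v ?g)) + ?h \<bullet> (?E *v ?h)"
      unfolding stage_form T_adj_form P_form[OF K] G' K'x
      by (simp add: matrix_vector_right_distrib matrix_vector_mult_diff_distrib
          inner_diff_left inner_diff_right inner_add_left inner_add_right sym)
    finally show ?thesis unfolding cost_increment_form D_def[symmetric] M_form H_form by simp
  qed
  \<comment> \<open>The two tuples agree as quadratic forms, not necessarily as matrices;
    semidefiniteness of X turns this into two inequalities.\<close>
  then have "?V \<bullet> X K' = cost_increment K (K' - K) \<bullet> X K'"
    by (intro antisym psd_inner_mono_tuple[OF psd_X[OF K']]) simp_all
  ultimately show ?thesis by simp
qed

lemma transpose_X: "K \<in> \<K> \<Longrightarrow> transpose (X K $ i) = X K $ i"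
  using psd_X unfolding psd_tuple_def psd_def by blast

lemma cost_gderiv:
  assumes K: "K \<in> \<K>"
  shows "GDERIV C K :> (\<chi> i. 2 *\<^sub>R (M K $ i ** X K $ i))"
proof (rule gderiv_factorization)
  let ?D = "\<lambda>K'. \<chi> i. 2 *\<^sub>R (M K $ i ** X K' $ i) + H K $ i ** (K' - K) $ i ** X K' $ i"
  have "C K' - C K = (K' - K) \<bullet> ?D K'" if K': "K' \<in> \<K>" for K'
    unfolding cost_diff[OF K K'] inner_vec_def[of "cost_increment K (K' - K)"] inner_vec_def[of "K' - K"]
    by (intro sum.cong refl)
       (simp add: cost_increment_def inner_add_left inner_add_right inner_transpose_mult_sym transpose_X K')
  then show "eventually (\<lambda>K'. C K' - C K = (K' - K) \<bullet> ?D K') (at K)"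
    using eventually_at_topological open_stab_gains K by blast
  have "(?D \<longlongrightarrow> (\<chi> i. 2 *\<^sub>R (M K $ i ** X K $ i) + H K $ i ** (K - K) $ i ** X K $ i)) (at K)"
    by (intro tendsto_intros X_tendsto K)
  then show "(?D \<longlongrightarrow> (\<chi> i. 2 *\<^sub>R (M K $ i ** X K $ i))) (at K)" by simp
qed

lemma grad_cost: "K \<in> \<K> \<Longrightarrow> grad C K = (\<chi> i. 2 *\<^sub>R (M K $ i ** X K $ i))"
  by (rule grad_eqI) (rule cost_gderiv)

text \<open>Row by row: by symmetry the rows of N X are X n for the rows n of N, and n . X n, which
  is at least \<mu> |n|^2, is at most |n| |X n|.\<close>

lemma norm_mult_X_ge:
  fixes N :: "real^'d^'m"
  assumes "K \<in> \<K>"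
  shows "\<mu> * norm N \<le> norm (N ** X K $ i)"
proof -
  have row: "\<mu> * norm (N $ a) \<le> norm ((N ** X K $ i) $ a)" for a
  proof -
    let ?n = "N $ a"
    have e: "(N ** X K $ i) $ a = X K $ i *v ?n"
      using transpose_X[OF assms, of i]
      by (simp add: matrix_matrix_mult_def matrix_vector_mult_def vec_eq_iff transpose_def mult.commute)
    have "\<mu> * (?n \<bullet> ?n) \<le> norm ?n * norm (X K $ i *v ?n)"
      using X_ge_mu[OF assms, of ?n i] norm_cauchy_schwarz[of ?n "X K $ i *v ?n"] by linarith
    then have "norm ?n * (\<mu> * norm ?n) \<le> norm ?n * norm (X K $ i *v ?n)"
      by (simp add: dot_square_norm power2_eq_square mult_ac)
    then show ?thesis unfolding e by (cases "?n = 0") (auto simp: mult_le_cancel_left)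
  qed
  have "\<mu> * norm N = L2_set (\<lambda>a. \<mu> * norm (N $ a)) UNIV"
    using mu_pos by (simp add: norm_vec_def[of N] L2_set_right_distrib)
  also have "\<dots> \<le> norm (N ** X K $ i)"
    unfolding norm_vec_def[of "N ** X K $ i"] using mu_pos by (intro L2_set_mono row) auto
  finally show ?thesis .
qed

lemma power2_norm_tuple: "(norm V)\<^sup>2 = (\<Sum>i\<in>UNIV. (norm (V $ i))\<^sup>2)" for V :: "(real^'n^'m)^'s"
  by (simp add: power2_norm_eq_inner inner_vec_def[of V V])

lemma norm_grad_ge:
  assumes "K \<in> \<K>"
  shows "4 * \<mu>\<^sup>2 * (norm (M K))\<^sup>2 \<le> (norm (grad C K))\<^sup>2"
proof -
  have "4 * \<mu>\<^sup>2 * (norm (M K $ i))\<^sup>2 \<le> (norm (grad C K $ i))\<^sup>2" for i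
  proof -
    have "4 * \<mu>\<^sup>2 * (norm (M K $ i))\<^sup>2 = (2 * (\<mu> * norm (M K $ i)))\<^sup>2" by (simp add: power_mult_distrib)
    also have "\<dots> \<le> (2 * norm (M K $ i ** X K $ i))\<^sup>2"
      using norm_mult_X_ge[OF assms, of "M K $ i" i] mu_pos by (intro power_mono mult_left_mono) auto
    also have "\<dots> = (norm (grad C K $ i))\<^sup>2" by (simp add: grad_cost[OF assms])
    finally show ?thesis .
  qed
  then show ?thesis unfolding power2_norm_tuple sum_distrib_left by (intro sum_mono)
qed

lemma gram_inner_le:
  fixes N :: "real^'d^'m"
  assumes "\<And>x. x \<bullet> (S *v x) \<le> \<kappa> * (x \<bullet> x)"
  shows "(transpose N ** N) \<bullet> S \<le> \<kappa> * (norm N)\<^sup>2"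
proof -
  have "S \<bullet> (transpose N ** N) \<le> (\<kappa> *\<^sub>R mat 1) \<bullet> (transpose N ** N)"
    using assms by (intro psd_inner_mono psd_gram) (simp add: scaleR_matrix_vector_assoc[symmetric])
  also have "\<dots> = \<kappa> * (norm N)\<^sup>2"
    using inner_matrix_mult_left[of "transpose N" N "mat 1"]
    by (simp add: inner_commute power2_norm_eq_inner)
  finally show ?thesis by (simp add: inner_commute)
qed

lemma gradient_dominance:
  assumes K: "K \<in> \<K>" and K': "K' \<in> \<K>"
  shows "4 * \<mu>\<^sup>2 * Lambda_min R * (C K - C K') \<le> max_norm (X K') * (norm (grad C K))\<^sup>2"
proof -
  let ?D = "K' - K" and ?l = "Lambda_min R"
  have l: "0 < ?l" by (rule Lambda_min_pos) (rule R_pd)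
  have "(- (1 / ?l) *\<^sub>R (\<chi> i. transpose (M K $ i) ** M K $ i)) \<bullet> X K' \<le> cost_increment K ?D \<bullet> X K'"
  proof (rule psd_inner_mono_tuple[OF psd_X[OF K']])
    fix i x
    define m d where "m = M K $ i *v x" and "d = ?D $ i *v x"
    \<comment> \<open>Keeping only the R part of H, the minimum of 2 d . m + l |d|^2 over d is
      -|m|^2 / l. This removes the unknown difference K' - K.\<close>
    have "0 \<le> (1 / ?l) * ((m + ?l *\<^sub>R d) \<bullet> (m + ?l *\<^sub>R d))" using l by simp
    also have "\<dots> = (1 / ?l) * (m \<bullet> m) + 2 * (d \<bullet> m) + ?l * (d \<bullet> d)"
      using l by (simp add: inner_add_left inner_add_right inner_commute[of m d] field_simps)
    finally have 1: "- (1 / ?l) * (m \<bullet> m) \<le> 2 * (d \<bullet> m) + ?l * (d \<bullet> d)" by simp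
    have "?l * (d \<bullet> d) \<le> d \<bullet> (R $ i *v d)" by (rule form_ge_Lambda_min) (rule R_pd)
    also have "\<dots> \<le> d \<bullet> (H K $ i *v d)"
      using psd_next_avg_P[OF K] unfolding psd_iff by (simp add: H_form)
    finally have "- (1 / ?l) * (m \<bullet> m) \<le> x \<bullet> (cost_increment K ?D $ i *v x)"
      using 1 unfolding cost_increment_form m_def[symmetric] d_def[symmetric] by simp
    then show "x \<bullet> ((- (1 / ?l) *\<^sub>R (\<chi> i. transpose (M K $ i) ** M K $ i)) $ i *v x)
        \<le> x \<bullet> (cost_increment K ?D $ i *v x)"
      by (simp add: scaleR_matrix_vector_assoc[symmetric] matrix_vector_mul_assoc[symmetric] m_def
          minus_matrix_vector_mult)
  qed
  then have "?l * (C K - C K') \<le> (\<chi> i. transpose (M K $ i) ** M K $ i) \<bullet> X K'"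
    unfolding cost_diff[OF K K', symmetric] using l by (simp add: field_simps)
  also have "\<dots> = (\<Sum>i\<in>UNIV. (transpose (M K $ i) ** M K $ i) \<bullet> X K' $ i)"
    by (simp add: inner_vec_def[of "\<chi> i. transpose (M K $ i) ** M K $ i"])
  also have "\<dots> \<le> (\<Sum>i\<in>UNIV. max_norm (X K') * (norm (M K $ i))\<^sup>2)"
    by (intro sum_mono gram_inner_le form_le_max_norm)
  also have "\<dots> = max_norm (X K') * (norm (M K))\<^sup>2"
    by (simp add: power2_norm_tuple[of "M K"] sum_distrib_left)
  finally have "4 * \<mu>\<^sup>2 * (?l * (C K - C K')) \<le> 4 * \<mu>\<^sup>2 * (max_norm (X K') * (norm (M K))\<^sup>2)"
    by (intro mult_left_mono) auto
  also have "\<dots> \<le> max_norm (X K') * (norm (grad C K))\<^sup>2"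
    using mult_left_mono[OF norm_grad_ge[OF K] max_norm_nonneg[of "X K'"]] by (simp add: mult_ac)
  finally show ?thesis by (simp add: mult_ac)
qed

section \<open>Second derivative of the cost along a line\<close>

text \<open>\<open>T1\<close>, \<open>T2\<close> and \<open>S1\<close>, \<open>S2\<close> are the coefficients of \<open>h\<close> and \<open>h\<^sup>2\<close> in \<open>T (K + h U)\<close> and
  \<open>stage (K + h U)\<close>. Differentiating \<open>P = stage K + T K P\<close> in direction \<open>U\<close> once and twice
  yields fixed-point equations for \<open>P'\<close> and \<open>P''\<close> with the sources \<open>S1 + T1 P\<close> and
  \<open>ddP_source\<close>; no derivative of \<open>X K\<close> is needed.\<close>

definition T1 :: "(real^'d^'k)^'s \<Rightarrow> (real^'d^'k)^'s \<Rightarrow> (real^'d^'d)^'s \<Rightarrow> (real^'d^'d)^'s" where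
  "T1 K U V = (\<chi> i. - (transpose (B $ i ** U $ i) ** next_avg p V i ** \<Gamma> K $ i)
     - transpose (\<Gamma> K $ i) ** next_avg p V i ** (B $ i ** U $ i))"

abbreviation T2 :: "(real^'d^'k)^'s \<Rightarrow> (real^'d^'d)^'s \<Rightarrow> (real^'d^'d)^'s" where
  "T2 U \<equiv> T_adj p (\<chi> i. B $ i ** U $ i)"

definition S1 :: "(real^'d^'k)^'s \<Rightarrow> (real^'d^'k)^'s \<Rightarrow> (real^'d^'d)^'s" where
  "S1 K U = (\<chi> i. transpose (U $ i) ** R $ i ** K $ i + transpose (K $ i) ** R $ i ** U $ i)"

definition S2 :: "(real^'d^'k)^'s \<Rightarrow> (real^'d^'d)^'s" where
  "S2 U = (\<chi> i. transpose (U $ i) ** R $ i ** U $ i)"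

definition dP :: "(real^'d^'k)^'s \<Rightarrow> (real^'d^'k)^'s \<Rightarrow> (real^'d^'d)^'s" where
  "dP K U = neumann (T K) (S1 K U + T1 K U (P K))"

lemma T1_form: "x \<bullet> (T1 K U V $ i *v y) =
    - ((B $ i *v (U $ i *v x)) \<bullet> (next_avg p V i *v (\<Gamma> K $ i *v y)))
    - (\<Gamma> K $ i *v x) \<bullet> (next_avg p V i *v (B $ i *v (U $ i *v y)))"
  by (simp add: T1_def matrix_vector_mult_diff_rdistrib inner_diff_right minus_matrix_vector_mult
      matrix_vector_mul_assoc[symmetric])

lemma T2_form: "x \<bullet> (T2 U V $ i *v y) =
    (B $ i *v (U $ i *v x)) \<bullet> (next_avg p V i *v (B $ i *v (U $ i *v y)))"
  by (simp add: T_adj_form matrix_vector_mul_assoc[symmetric])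

lemma S1_form: "x \<bullet> (S1 K U $ i *v y) =
    (U $ i *v x) \<bullet> (R $ i *v (K $ i *v y)) + (K $ i *v x) \<bullet> (R $ i *v (U $ i *v y))"
  by (simp add: S1_def matrix_vector_mult_add_rdistrib inner_add_right matrix_vector_mul_assoc[symmetric])

lemma S2_form: "x \<bullet> (S2 U $ i *v y) = (U $ i *v x) \<bullet> (R $ i *v (U $ i *v y))"
  by (simp add: S2_def matrix_vector_mul_assoc[symmetric])

lemmas form_expand = matrix_vector_mult_add_rdistrib matrix_vector_mult_diff_rdistrib
  matrix_vector_right_distrib matrix_vector_mult_diff_distrib scaleR_matrix_vector_assoc[symmetric]
  matrix_vector_mult_scaleR inner_add_left inner_add_right inner_diff_left inner_diff_right

lemma Gamma_shift: "\<Gamma> (K + h *\<^sub>R U) $ i *v x = \<Gamma> K $ i *v x - h *\<^sub>R (B $ i *v (U $ i *v x))"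
  by (simp add: Gamma_mult form_expand)

lemma T_expand: "T (K + h *\<^sub>R U) V = T K V + h *\<^sub>R T1 K U V + h\<^sup>2 *\<^sub>R T2 U V"
  by (rule tuple_eqI_form)
     (simp add: T_adj_form[of _ p "\<Gamma> _"] T1_form T2_form Gamma_shift form_expand algebra_simps power2_eq_square)

lemma T1_expand: "T1 (K + h *\<^sub>R U) U V = T1 K U V + (2 * h) *\<^sub>R T2 U V"
  by (rule tuple_eqI_form)
     (simp add: T1_form T2_form Gamma_shift form_expand algebra_simps)

lemma stage_expand: "stage (K + h *\<^sub>R U) = stage K + h *\<^sub>R S1 K U + h\<^sup>2 *\<^sub>R S2 U"
  by (rule tuple_eqI_form)
     (simp add: stage_form S1_form S2_form form_expand algebra_simps power2_eq_square)

lemma S1_expand: "S1 (K + h *\<^sub>R U) U = S1 K U + (2 * h) *\<^sub>R S2 U"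
  by (rule tuple_eqI_form)
     (simp add: S1_form S2_form form_expand algebra_simps)

lemma linear_T1: "linear (T1 K U)"
  by (rule linearI; rule tuple_eqI_form)
     (simp_all add: T1_form next_avg_add next_avg_scaleR form_expand algebra_simps)

lemma line_split: "K + r *\<^sub>R U = (K + s *\<^sub>R U) + (r - s) *\<^sub>R U" for K U :: "(real^'d^'k)^'s"
  by (simp add: algebra_simps)

lemma eventually_stab_line:
  assumes "K + s *\<^sub>R U \<in> \<K>"
  shows "eventually (\<lambda>r. K + r *\<^sub>R U \<in> \<K>) (nhds s)"
proof -
  have "((\<lambda>r. K + r *\<^sub>R U) \<longlongrightarrow> K + s *\<^sub>R U) (nhds s)"
    by (intro tendsto_intros filterlim_ident)
  then show ?thesis using topological_tendstoD[OF _ open_stab_gains assms] by blast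
qed

lemma P_has_vector_derivative:
  assumes "K + s *\<^sub>R U \<in> \<K>"
  shows "((\<lambda>r. P (K + r *\<^sub>R U)) has_vector_derivative dP (K + s *\<^sub>R U) U) (at s)"
  unfolding dP_def
proof (rule fixpoint_has_vector_derivative[where T = "\<lambda>r. T (K + r *\<^sub>R U)" and DT = "T1 (K + s *\<^sub>R U) U"
      and DDT = "T2 U" and c = "\<lambda>r. stage (K + r *\<^sub>R U)"])
  show "eventually (\<lambda>r. P (K + r *\<^sub>R U) = stage (K + r *\<^sub>R U) + T (K + r *\<^sub>R U) (P (K + r *\<^sub>R U))) (at s)"
    using eventually_stab_line[OF assms] unfolding eventually_at_filter
    by (rule eventually_mono) (simp add: P_fix[symmetric])
  have "((\<lambda>r. stage (K + s *\<^sub>R U) + (r - s) *\<^sub>R S1 (K + s *\<^sub>R U) U + (r - s)\<^sup>2 *\<^sub>R S2 U)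
      has_vector_derivative S1 (K + s *\<^sub>R U) U) (at s)"
    by (auto intro!: derivative_eq_intros)
  then show "((\<lambda>r. stage (K + r *\<^sub>R U)) has_vector_derivative S1 (K + s *\<^sub>R U) U) (at s)"
    by (subst line_split[of K _ U s]) (simp add: stage_expand)
  show "T (K + r *\<^sub>R U) V = T (K + s *\<^sub>R U) V + (r - s) *\<^sub>R T1 (K + s *\<^sub>R U) U V + (r - s)\<^sup>2 *\<^sub>R T2 U V"
    for r V
    using T_expand[of "K + s *\<^sub>R U" "r - s" U V] by (simp only: line_split[of K r U s, symmetric])
qed (use assms in \<open>auto simp: stab_iff[symmetric] intro: P_fix linear_T_adj linear_T1\<close>)

definition ddP_source :: "(real^'d^'k)^'s \<Rightarrow> (real^'d^'k)^'s \<Rightarrow> (real^'d^'d)^'s" where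
  "ddP_source K U = 2 *\<^sub>R (S2 U + T1 K U (dP K U) + T2 U (P K))"

lemma dP_has_vector_derivative:
  assumes "K + s *\<^sub>R U \<in> \<K>"
  shows "((\<lambda>r. dP (K + r *\<^sub>R U) U) has_vector_derivative
      neumann (T (K + s *\<^sub>R U)) (ddP_source (K + s *\<^sub>R U) U)) (at s)"
proof -
  let ?K = "K + s *\<^sub>R U" and ?P = "\<lambda>r. P (K + r *\<^sub>R U)"
  let ?c = "\<lambda>r. S1 (K + r *\<^sub>R U) U + T1 (K + r *\<^sub>R U) U (?P r)"
  \<comment> \<open>The term T1 (dP) arises twice, here from differentiating P inside the source and
    once more from differentiating the operator; hence the common factor 2 in
    \<open>ddP_source\<close>.\<close>
  let ?c' = "2 *\<^sub>R S2 U + (T1 ?K U (dP ?K U) + 2 *\<^sub>R T2 U (P ?K))"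
  have "((\<lambda>r. dP (K + r *\<^sub>R U) U) has_vector_derivative
      neumann (T ?K) (?c' + T1 ?K U (dP ?K U))) (at s)"
  proof (rule fixpoint_has_vector_derivative[where T = "\<lambda>r. T (K + r *\<^sub>R U)" and DT = "T1 (K + s *\<^sub>R U) U"
        and DDT = "T2 U" and c = "?c"])
    have dP_fix: "dP K' U = S1 K' U + T1 K' U (P K') + T K' (dP K' U)" if "K' \<in> \<K>" for K'
      unfolding dP_def using that by (intro neumann_unfold) (simp add: stab_iff)
    show "dP ?K U = ?c s + T ?K (dP ?K U)" by (rule dP_fix[OF assms])
    show "eventually (\<lambda>r. dP (K + r *\<^sub>R U) U = ?c r + T (K + r *\<^sub>R U) (dP (K + r *\<^sub>R U) U)) (at s)"
      using eventually_stab_line[OF assms] unfolding eventually_at_filter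
      by (rule eventually_mono) (simp add: dP_fix[symmetric])
    have d: "((\<lambda>r. L (?P r)) has_vector_derivative L (dP ?K U)) (at s)" if "linear L"
      for L :: "(real^'d^'d)^'s \<Rightarrow> (real^'d^'d)^'s"
      using that P_has_vector_derivative[OF assms] bounded_linear.has_vector_derivative
        linear_conv_bounded_linear by blast
    have "((\<lambda>r. S1 ?K U + (2 * (r - s)) *\<^sub>R S2 U + (T1 ?K U (?P r) + (2 * (r - s)) *\<^sub>R T2 U (?P r)))
      has_vector_derivative ?c') (at s)"
      by (rule derivative_eq_intros d[OF linear_T1] d[OF linear_T_adj] refl | simp)+
    then show "(?c has_vector_derivative ?c') (at s)"
      by (subst (1 2) line_split[of K _ U s]) (simp only: S1_expand T1_expand)
    show "T (K + r *\<^sub>R U) V = T ?K V + (r - s) *\<^sub>R T1 ?K U V + (r - s)\<^sup>2 *\<^sub>R T2 U V" for r V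
      using T_expand[of ?K "r - s" U V] by (simp only: line_split[of K r U s, symmetric])
  qed (use assms in \<open>auto simp: stab_iff[symmetric] intro: linear_T_adj linear_T1\<close>)
  moreover have "?c' + T1 ?K U (dP ?K U) = ddP_source ?K U"
    by (simp add: ddP_source_def scaleR_add_right scaleR_2)
  ultimately show ?thesis by simp
qed

text \<open>The slope is computed once through P and once through the gradient; uniqueness of
  derivatives identifies the two, and the second derivative moves onto X by adjointness.\<close>

lemma cost_line_derivatives:
  assumes "K + s *\<^sub>R U \<in> \<K>"
  shows "((\<lambda>r. C (K + r *\<^sub>R U)) has_real_derivative dP (K + s *\<^sub>R U) U \<bullet> X0) (at s)"
    and "((\<lambda>r. dP (K + r *\<^sub>R U) U \<bullet> X0) has_real_derivative
      ddP_source (K + s *\<^sub>R U) U \<bullet> X (K + s *\<^sub>R U)) (at s)"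
    and "dP (K + s *\<^sub>R U) U \<bullet> X0 = U \<bullet> grad C (K + s *\<^sub>R U)"
proof -
  let ?K = "K + s *\<^sub>R U"
  have "((\<lambda>r. P (K + r *\<^sub>R U) \<bullet> X0) has_real_derivative dP ?K U \<bullet> X0) (at s)"
    unfolding has_real_derivative_iff_has_vector_derivative
    by (rule bounded_linear.has_vector_derivative[OF bounded_linear_inner_left P_has_vector_derivative[OF assms]])
  moreover have ev: "eventually (\<lambda>r. P (K + r *\<^sub>R U) \<bullet> X0 = C (K + r *\<^sub>R U)) (nhds s)"
    using eventually_stab_line[OF assms] by (rule eventually_mono) (simp add: cost_eq_P_X0)
  ultimately show 1: "((\<lambda>r. C (K + r *\<^sub>R U)) has_real_derivative dP ?K U \<bullet> X0) (at s)"
    by (simp only: DERIV_cong_ev[OF refl ev refl])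
  have "((\<lambda>r. dP (K + r *\<^sub>R U) U \<bullet> X0) has_real_derivative
      neumann (T ?K) (ddP_source ?K U) \<bullet> X0) (at s)"
    unfolding has_real_derivative_iff_has_vector_derivative
    by (rule bounded_linear.has_vector_derivative[OF bounded_linear_inner_left dP_has_vector_derivative[OF assms]])
  then show "((\<lambda>r. dP (K + r *\<^sub>R U) U \<bullet> X0) has_real_derivative ddP_source ?K U \<bullet> X ?K) (at s)"
    by (simp only: neumann_inner_X0[OF assms])
  have "((\<lambda>r. K + r *\<^sub>R U) has_derivative (\<lambda>h. h *\<^sub>R U)) (at s)"
    by (auto intro!: derivative_eq_intros)
  moreover have "(C has_derivative (\<lambda>h. h \<bullet> grad C ?K)) (at ?K)"
    using cost_gderiv[OF assms] unfolding grad_cost[OF assms] gderiv_def .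
  ultimately have "((\<lambda>r. C (K + r *\<^sub>R U)) has_derivative (\<lambda>h. (h *\<^sub>R U) \<bullet> grad C ?K)) (at s)"
    by (rule has_derivative_compose)
  then have "((\<lambda>r. C (K + r *\<^sub>R U)) has_real_derivative U \<bullet> grad C ?K) (at s)"
    by (simp add: has_field_derivative_def mult.commute mult_commute_abs)
  then show "dP ?K U \<bullet> X0 = U \<bullet> grad C ?K" using 1 DERIV_unique by blast
qed

end

lemma taylor_quadratic_upper_bound:
  fixes f :: "real \<Rightarrow> real"
  assumes "0 \<le> s"
    and f': "\<And>r. 0 \<le> r \<Longrightarrow> r \<le> s \<Longrightarrow> (f has_real_derivative f' r) (at r)"
    and f'': "\<And>r. 0 \<le> r \<Longrightarrow> r \<le> s \<Longrightarrow> (f' has_real_derivative f'' r) (at r)"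
    and le: "\<And>r. 0 \<le> r \<Longrightarrow> r \<le> s \<Longrightarrow> f'' r \<le> L"
  shows "f s \<le> f 0 + s * f' 0 + L * s\<^sup>2 / 2"
proof -
  have slope: "f' r \<le> f' 0 + L * r" if "0 \<le> r" "r \<le> s" for r
  proof -
    have "L * 0 - f' 0 \<le> L * r - f' r"
    proof (rule DERIV_nonneg_imp_nondecreasing[OF that(1)])
      fix x assume x: "0 \<le> x" "x \<le> r"
      have "((\<lambda>x. L * x - f' x) has_real_derivative L - f'' x) (at x)"
        using x that by (auto intro!: derivative_eq_intros f'')
      then show "\<exists>y. ((\<lambda>x. L * x - f' x) has_real_derivative y) (at x) \<and> 0 \<le> y"
        using le[of x] x that by auto
    qed
    then show ?thesis by simp
  qed
  have "f 0 + 0 * f' 0 + L * 0\<^sup>2 / 2 - f 0 \<le> f 0 + s * f' 0 + L * s\<^sup>2 / 2 - f s"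
  proof (rule DERIV_nonneg_imp_nondecreasing[OF assms(1)])
    fix x assume x: "0 \<le> x" "x \<le> s"
    have "((\<lambda>x. f 0 + x * f' 0 + L * x\<^sup>2 / 2 - f x) has_real_derivative f' 0 + L * x - f' x) (at x)"
      using x by (auto intro!: derivative_eq_intros f')
    then show "\<exists>y. ((\<lambda>x. f 0 + x * f' 0 + L * x\<^sup>2 / 2 - f x) has_real_derivative y) (at x) \<and> 0 \<le> y"
      using slope[OF x] by auto
  qed
  then show ?thesis by simp
qed

text \<open>The factor may be negative; then nonnegativity of the sequence forces it to vanish
  identically.\<close>

lemma geometric_decay:
  fixes a :: "nat \<Rightarrow> real"
  assumes nonneg: "\<And>n. 0 \<le> a n" and step: "\<And>n. a (Suc n) \<le> q * a n"
  shows "a n \<le> q ^ n * a 0"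
proof (cases "0 \<le> q")
  case True
  show ?thesis
  proof (induction n)
    case (Suc n)
    have "a (Suc n) \<le> q * (q ^ n * a 0)"
      using step[of n] mult_left_mono[OF Suc True] by linarith
    then show ?case by simp
  qed simp
next
  case False
  have "a n = 0" for n
  proof -
    have "0 \<le> q * a n" using nonneg[of "Suc n"] step[of n] by linarith
    then show ?thesis using False nonneg[of n] by (simp add: zero_le_mult_iff)
  qed
  then show ?thesis by simp
qed

section \<open>Descent along the gradient step\<close>

context mjls
begin

definition \<xi> :: "real \<Rightarrow> real" where
  "\<xi> \<alpha> = (1 / qmin) * ((1 + (max_norm B)\<^sup>2) / \<mu> * \<alpha> + max_norm R) - 1"

definition L :: "real \<Rightarrow> real" where
  "L \<alpha> = 2 * (max_norm R + (max_norm B)\<^sup>2 * (1 + 2 * \<xi> \<alpha> / max_norm B) * (\<alpha> / \<mu>)) * (\<alpha> / qmin)"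

context
  fixes K :: "(real^'d^'k)^'s" and \<alpha> :: real
  assumes K: "K \<in> \<K>" and C_le: "C K \<le> \<alpha>"
begin

lemma P_le_level: "x \<bullet> (P K $ i *v x) \<le> \<alpha> / \<mu> * (x \<bullet> x)"
proof -
  have "C K / \<mu> * (x \<bullet> x) \<le> \<alpha> / \<mu> * (x \<bullet> x)"
    using C_le mu_pos by (intro mult_right_mono divide_right_mono) auto
  then show ?thesis using P_le[OF K, of x i] by linarith
qed

lemma level_pos: "0 < \<alpha>" using cost_pos[OF K] C_le by linarith

text \<open>On the sublevel set qmin is below Q, Q below P, and P below \<alpha>/\<mu>, so the
  bracket in \<xi> is at least qmin.\<close>

lemma xi_nonneg: "0 \<le> \<xi> \<alpha>"
proof -
  have ax: "axis a 1 \<bullet> (axis a 1 :: real^'d) = 1" for a by (simp add: inner_axis)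
  have "qmin \<le> \<alpha> / \<mu>"
    using Q_ge[of "axis undefined 1" undefined] P_ge_Q[OF K, of "axis undefined 1" undefined]
      P_le_level[of "axis undefined 1" undefined] by (simp add: ax)
  also have "\<dots> \<le> (1 + (max_norm B)\<^sup>2) / \<mu> * \<alpha> + max_norm R"
    using level_pos mu_pos max_norm_nonneg[of R] by (simp add: field_simps)
  finally show ?thesis unfolding \<xi>_def using qmin_pos by (simp add: field_simps)
qed

text \<open>The origin of \<xi>. Young's inequality splits the source into squares of B U, \<Gamma>,
  U and K. Those of \<Gamma> and K add up to P - Q; the others are at most |B|^2 \<alpha>/\<mu> and
  |R|. Relative to qmin the bounds total \<xi> + 1, and the -1 is the Q missing from P. Enlarging Q
  to \<open>stage K\<close> at the end makes the comparison solution \<xi> P.\<close>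

lemma dP_source_dominated:
  assumes U: "norm U = 1"
  shows "dominated (S1 K U + T1 K U (P K)) (\<xi> \<alpha> *\<^sub>R stage K)"
  unfolding dominated_def
proof (intro allI)
  fix i x y
  let ?E = "next_avg p (P K) i"
  define z where "z x = (B $ i *v (U $ i *v x)) \<bullet> (?E *v (B $ i *v (U $ i *v x)))
     + (\<Gamma> K $ i *v x) \<bullet> (?E *v (\<Gamma> K $ i *v x))
     + (U $ i *v x) \<bullet> (R $ i *v (U $ i *v x)) + (K $ i *v x) \<bullet> (R $ i *v (K $ i *v x))" for x
  have z: "z x \<le> \<xi> \<alpha> * (x \<bullet> (stage K $ i *v x))" for x
  proof -
    have Ux: "(norm (U $ i *v x))\<^sup>2 \<le> x \<bullet> x"
      using norm_nth_matrix_le[of U i x] unfolding U dot_square_norm by (intro power_mono) auto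
    have "(U $ i *v x) \<bullet> (R $ i *v (U $ i *v x)) \<le> max_norm R * ((U $ i *v x) \<bullet> (U $ i *v x))"
      by (rule form_le_max_norm)
    also have "\<dots> \<le> max_norm R * (x \<bullet> x)"
      using Ux by (intro mult_left_mono max_norm_nonneg) (simp add: dot_square_norm)
    finally have r: "(U $ i *v x) \<bullet> (R $ i *v (U $ i *v x)) \<le> max_norm R * (x \<bullet> x)" .
    have "(norm (B $ i *v (U $ i *v x)))\<^sup>2 \<le> (max_norm B * norm (U $ i *v x))\<^sup>2"
      by (intro power_mono norm_le_max_norm) simp
    also have "\<dots> \<le> (max_norm B)\<^sup>2 * (x \<bullet> x)"
      using Ux by (simp add: power_mult_distrib mult_left_mono)
    finally have BU: "(norm (B $ i *v (U $ i *v x)))\<^sup>2 \<le> (max_norm B)\<^sup>2 * (x \<bullet> x)" .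
    have "(B $ i *v (U $ i *v x)) \<bullet> (?E *v (B $ i *v (U $ i *v x)))
        \<le> \<alpha> / \<mu> * ((B $ i *v (U $ i *v x)) \<bullet> (B $ i *v (U $ i *v x)))"
      by (rule next_avg_le) (rule P_le_level)
    also have "\<dots> \<le> \<alpha> / \<mu> * ((max_norm B)\<^sup>2 * (x \<bullet> x))"
      using BU level_pos mu_pos by (intro mult_left_mono) (auto simp: dot_square_norm)
    finally have b: "(B $ i *v (U $ i *v x)) \<bullet> (?E *v (B $ i *v (U $ i *v x)))
        \<le> \<alpha> / \<mu> * ((max_norm B)\<^sup>2 * (x \<bullet> x))" .
    have "z x \<le> \<alpha> / \<mu> * ((max_norm B)\<^sup>2 * (x \<bullet> x)) + \<alpha> / \<mu> * (x \<bullet> x) + max_norm R * (x \<bullet> x)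
        - x \<bullet> (Q $ i *v x)"
      using r b P_le_level[of x i] unfolding z_def P_form[OF K] by linarith
    also have "\<dots> = (\<xi> \<alpha> + 1) * (qmin * (x \<bullet> x)) - x \<bullet> (Q $ i *v x)"
      unfolding \<xi>_def using qmin_pos mu_pos by (simp add: field_simps)
    also have "\<dots> \<le> (\<xi> \<alpha> + 1) * (x \<bullet> (Q $ i *v x)) - x \<bullet> (Q $ i *v x)"
      using Q_ge[of x i] xi_nonneg by (intro diff_right_mono mult_left_mono) auto
    also have "\<dots> = \<xi> \<alpha> * (x \<bullet> (Q $ i *v x))" by (simp add: algebra_simps)
    also have "\<dots> \<le> \<xi> \<alpha> * (x \<bullet> (stage K $ i *v x))"
      using psd_R unfolding psd_iff by (intro mult_left_mono xi_nonneg) (simp add: stage_form)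
    finally show ?thesis .
  qed
  have E: "a \<bullet> (?E *v b) \<le> (a \<bullet> (?E *v a) + b \<bullet> (?E *v b)) / 2" for a b
    by (rule psd_young[OF psd_next_avg_P[OF K]])
  have Rf: "a \<bullet> (R $ i *v b) \<le> (a \<bullet> (R $ i *v a) + b \<bullet> (R $ i *v b)) / 2" for a b
    by (rule psd_young[OF psd_R])
  have neg: "- (a \<bullet> (?E *v b)) \<le> (a \<bullet> (?E *v a) + b \<bullet> (?E *v b)) / 2" for a b
    using E[of "- a" b] by (simp add: matrix_vector_mult_diff_distrib[of ?E 0 a, simplified])
  have "x \<bullet> ((S1 K U + T1 K U (P K)) $ i *v y)
      = (U $ i *v x) \<bullet> (R $ i *v (K $ i *v y)) + (K $ i *v x) \<bullet> (R $ i *v (U $ i *v y))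
       - (B $ i *v (U $ i *v x)) \<bullet> (?E *v (\<Gamma> K $ i *v y))
       - (\<Gamma> K $ i *v x) \<bullet> (?E *v (B $ i *v (U $ i *v y)))"
    by (simp add: matrix_vector_mult_add_rdistrib inner_add_right S1_form T1_form)
  also have "\<dots> \<le> (z x + z y) / 2"
    using Rf[of "U $ i *v x" "K $ i *v y"] Rf[of "K $ i *v x" "U $ i *v y"]
      neg[of "B $ i *v (U $ i *v x)" "\<Gamma> K $ i *v y"] neg[of "\<Gamma> K $ i *v x" "B $ i *v (U $ i *v y)"]
    unfolding z_def by (simp add: field_simps)
  also have "\<dots> \<le> (\<xi> \<alpha> * (x \<bullet> (stage K $ i *v x)) + \<xi> \<alpha> * (y \<bullet> (stage K $ i *v y))) / 2"
    using z[of x] z[of y] by simp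
  finally show "x \<bullet> ((S1 K U + T1 K U (P K)) $ i *v y)
      \<le> (x \<bullet> ((\<xi> \<alpha> *\<^sub>R stage K) $ i *v x) + y \<bullet> ((\<xi> \<alpha> *\<^sub>R stage K) $ i *v y)) / 2"
    by (simp add: scaleR_matrix_vector_assoc[symmetric])
qed

lemma dP_dominated:
  assumes "norm U = 1"
  shows "dominated (dP K U) (\<xi> \<alpha> *\<^sub>R P K)"
proof -
  have "dominated (dP K U) (neumann (T K) (\<xi> \<alpha> *\<^sub>R stage K))"
    unfolding dP_def using K stab_iff
    by (intro dominated_neumann dP_source_dominated[OF assms]) (auto intro: p_nonneg)
  moreover have "geometric (T K)" using K by (simp add: stab_iff)
  ultimately show ?thesis by (simp add: P_def linear_cmul[OF linear_neumann])
qed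

lemma next_avg_dP_le:
  assumes "norm U = 1"
  shows "x \<bullet> (next_avg p (dP K U) i *v y) \<le> \<xi> \<alpha> * (\<alpha> / \<mu>) * (norm x * norm y)"
proof (rule form_le_scale_invariant)
  fix x y :: "real^'d"
  let ?\<kappa> = "\<xi> \<alpha> * (\<alpha> / \<mu>)"
  have "x \<bullet> (dP K U $ j *v y) \<le> ?\<kappa> * ((x \<bullet> x + y \<bullet> y) / 2)" for j
  proof -
    have "x \<bullet> (dP K U $ j *v y) \<le> (\<xi> \<alpha> * (x \<bullet> (P K $ j *v x)) + \<xi> \<alpha> * (y \<bullet> (P K $ j *v y))) / 2"
      using dP_dominated[OF assms] unfolding dominated_def by (simp add: scaleR_matrix_vector_assoc[symmetric])
    also have "\<dots> \<le> (\<xi> \<alpha> * (\<alpha> / \<mu> * (x \<bullet> x)) + \<xi> \<alpha> * (\<alpha> / \<mu> * (y \<bullet> y))) / 2"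
      by (intro divide_right_mono add_mono mult_left_mono P_le_level xi_nonneg) simp
    also have "(a * (k * u) + a * (k * v)) / 2 = a * k * ((u + v) / 2)" for a k u v :: real
      by (simp add: algebra_simps)
    finally show ?thesis .
  qed
  then have "(\<Sum>j\<in>UNIV. p i j * (x \<bullet> (dP K U $ j *v y)))
      \<le> (\<Sum>j\<in>UNIV. p i j * (?\<kappa> * ((x \<bullet> x + y \<bullet> y) / 2)))"
    by (intro sum_mono mult_left_mono p_nonneg)
  also have "\<dots> = ?\<kappa> * ((x \<bullet> x + y \<bullet> y) / 2)"
    by (simp only: sum_distrib_right[symmetric] p_stoch mult_1)
  finally show "x \<bullet> (next_avg p (dP K U) i *v y) \<le> ?\<kappa> * ((x \<bullet> x + y \<bullet> y) / 2)"
    by (simp add: next_avg_form)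
qed

text \<open>With u = U x and g = \<Gamma> x the source is bounded by \<open>?a\<close> |u|^2 +
  \<open>?e\<close> |g|^2, where the mixed term contributes equally to both. Paired with X, each
  square is at most tr X: the first because |U| = 1, the second because X = X0 + \<open>T_op\<close>
  X.\<close>

lemma hessian_le:
  assumes U: "norm U = 1"
  shows "ddP_source K U \<bullet> X K \<le> L \<alpha>"
proof -
  define b c r where "b = max_norm B" and "c = \<alpha> / \<mu>" and "r = max_norm R"
  define \<kappa> where "\<kappa> = \<xi> \<alpha> * c"
  have nn: "0 \<le> b" "0 \<le> c" "0 \<le> r" "0 \<le> \<kappa>"
    using max_norm_nonneg level_pos mu_pos xi_nonneg unfolding b_def c_def r_def \<kappa>_def by auto
  let ?a = "2 * (r + c * b\<^sup>2) + 2 * \<kappa> * b" and ?e = "2 * \<kappa> * b"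
  let ?UU = "(\<chi> i. transpose (U $ i) ** U $ i) :: (real^'d^'d)^'s"
  let ?I = "(\<chi> i. mat 1) :: (real^'d^'d)^'s"
  have GG: "x \<bullet> (T K ?I $ i *v x) = (\<Gamma> K $ i *v x) \<bullet> (\<Gamma> K $ i *v x)" for i x
    by (simp add: T_adj_form next_avg_form sum_distrib_right[symmetric] p_stoch)
  have "ddP_source K U \<bullet> X K \<le> (?a *\<^sub>R ?UU + ?e *\<^sub>R T K ?I) \<bullet> X K"
  proof (rule psd_inner_mono_tuple[OF psd_X[OF K]])
    fix i x
    define u g where "u = U $ i *v x" and "g = \<Gamma> K $ i *v x"
    let ?h = "B $ i *v u"
    have h: "norm ?h \<le> b * norm u" unfolding b_def by (rule norm_le_max_norm)
    have s2: "u \<bullet> (R $ i *v u) \<le> r * (u \<bullet> u)" unfolding r_def by (rule form_le_max_norm)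
    have "?h \<bullet> (next_avg p (P K) i *v ?h) \<le> c * (?h \<bullet> ?h)"
      unfolding c_def by (rule next_avg_le) (rule P_le_level)
    also have "\<dots> \<le> c * (b\<^sup>2 * (u \<bullet> u))"
      using power_mono[OF h norm_ge_zero, of 2] nn
      by (intro mult_left_mono) (auto simp: dot_square_norm power_mult_distrib)
    finally have t2: "?h \<bullet> (next_avg p (P K) i *v ?h) \<le> c * (b\<^sup>2 * (u \<bullet> u))" .
    have hg: "\<kappa> * (norm ?h * norm g) \<le> \<kappa> * b * ((u \<bullet> u + g \<bullet> g) / 2)"
    proof -
      have "norm ?h * norm g \<le> (b * norm u) * norm g" using h by (intro mult_right_mono) auto
      also have "\<dots> = b * (norm u * norm g)" by simp
      also have "\<dots> \<le> b * ((u \<bullet> u + g \<bullet> g) / 2)"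
        using sum_squares_bound[of "norm u" "norm g"] nn
        by (intro mult_left_mono) (auto simp: dot_square_norm)
      finally show ?thesis using nn by (simp add: mult_left_mono mult.assoc)
    qed
    have V: "x \<bullet> (next_avg p (dP K U) i *v y) \<le> \<kappa> * (norm x * norm y)" for x y
      unfolding \<kappa>_def c_def by (rule next_avg_dP_le[OF U])
    have t1: "- (?h \<bullet> (next_avg p (dP K U) i *v g)) - g \<bullet> (next_avg p (dP K U) i *v ?h)
        \<le> \<kappa> * b * (u \<bullet> u + g \<bullet> g)"
      using V[of "- ?h" g] V[of "- g" ?h] hg by (simp add: mult.commute[of "norm g"])
    have "x \<bullet> (ddP_source K U $ i *v x) = 2 * (u \<bullet> (R $ i *v u)
        + (- (?h \<bullet> (next_avg p (dP K U) i *v g)) - g \<bullet> (next_avg p (dP K U) i *v ?h))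
        + ?h \<bullet> (next_avg p (P K) i *v ?h))"
      by (simp add: ddP_source_def form_expand S2_form T1_form T2_form u_def g_def)
    also have "\<dots> \<le> 2 * (r * (u \<bullet> u) + \<kappa> * b * (u \<bullet> u + g \<bullet> g) + c * (b\<^sup>2 * (u \<bullet> u)))"
      using s2 t1 t2 by (intro mult_left_mono add_mono) auto
    also have "\<dots> = ?a * (u \<bullet> u) + ?e * (g \<bullet> g)" by (simp add: algebra_simps)
    finally show "x \<bullet> (ddP_source K U $ i *v x) \<le> x \<bullet> ((?a *\<^sub>R ?UU + ?e *\<^sub>R T K ?I) $ i *v x)"
      by (simp add: form_expand GG matrix_vector_mul_assoc[symmetric] u_def g_def)
  qed
  also have "\<dots> = ?a * (?UU \<bullet> X K) + ?e * (T K ?I \<bullet> X K)"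
    by (simp add: inner_add_left)
  also have "\<dots> \<le> ?a * tr (X K) + ?e * tr (X K)"
  proof (intro add_mono mult_left_mono)
    have "?UU \<bullet> X K = (\<Sum>i\<in>UNIV. (transpose (U $ i) ** U $ i) \<bullet> X K $ i)"
      by (simp add: inner_vec_def[of ?UU])
    also have "\<dots> \<le> (\<Sum>i\<in>UNIV. tr (X K) * (norm (U $ i))\<^sup>2)"
      by (intro sum_mono gram_inner_le psd_form_le_tr psd_X K)
    also have "\<dots> = tr (X K)"
      using U power2_norm_tuple[of U] by (simp add: sum_distrib_left[symmetric])
    finally show "?UU \<bullet> X K \<le> tr (X K)" .
    have "0 \<le> ?I \<bullet> X0" using psd_inner_mono_tuple[OF psd_X0, of 0 ?I] by simp
    moreover have "?I \<bullet> X K = ?I \<bullet> X0 + ?I \<bullet> T_op p (\<Gamma> K) (X K)"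
      by (subst X_fix[OF K]) (rule inner_add_right)
    ultimately show "T K ?I \<bullet> X K \<le> tr (X K)" by (simp add: T_adj_inner)
  qed (use nn in auto)
  also have "\<dots> = (?a + ?e) * tr (X K)" by (simp add: algebra_simps)
  also have "\<dots> \<le> (?a + ?e) * (\<alpha> / qmin)"
    using tr_X_le[OF K] C_le qmin_pos nn by (intro mult_left_mono) (auto simp: field_simps)
  also have "?a + ?e = 2 * (r + (b\<^sup>2 + 2 * \<xi> \<alpha> * b) * c)"
    by (simp add: \<kappa>_def algebra_simps)
  \<comment> \<open>For b = 0 the quotient is 0 by convention and both sides vanish, so L stays
    correct when B is zero.\<close>
  also have "b\<^sup>2 + 2 * \<xi> \<alpha> * b = b\<^sup>2 * (1 + 2 * \<xi> \<alpha> / b)"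
    by (simp add: field_simps power2_eq_square)
  also have "2 * (r + b\<^sup>2 * (1 + 2 * \<xi> \<alpha> / b) * c) * (\<alpha> / qmin) = L \<alpha>"
    unfolding L_def b_def c_def r_def ..
  finally show ?thesis .
qed

lemma L_pos: "0 < L \<alpha>"
proof -
  have R0: "0 < max_norm R"
  proof -
    have "Lambda_min R * (axis undefined 1 \<bullet> (axis undefined 1 :: real^'k))
        \<le> max_norm R * (axis undefined 1 \<bullet> (axis undefined 1 :: real^'k))"
      using form_ge_Lambda_min[of R "axis undefined 1" undefined] R_pd
        form_le_max_norm[of "axis undefined 1" R undefined] by fastforce
    then show ?thesis using Lambda_min_pos[of R] R_pd by (simp add: inner_axis)
  qed
  have "0 \<le> (max_norm B)\<^sup>2 * (1 + 2 * \<xi> \<alpha> / max_norm B) * (\<alpha> / \<mu>)"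
    using max_norm_nonneg[of B] xi_nonneg level_pos mu_pos by simp
  then show ?thesis
    unfolding L_def using R0 level_pos qmin_pos by (intro mult_pos_pos add_pos_nonneg) auto
qed

end

lemma descent:
  assumes K: "K \<in> \<K>" and C_le: "C K \<le> \<alpha>" and \<eta>: "0 < \<eta>" "\<eta> \<le> 1 / L \<alpha>"
  shows "K - \<eta> *\<^sub>R grad C K \<in> \<K> \<and> C (K - \<eta> *\<^sub>R grad C K) \<le> C K - \<eta> / 2 * (norm (grad C K))\<^sup>2"
proof (cases "grad C K = 0")
  case True
  then show ?thesis using K by simp
next
  case False
  define \<delta> where "\<delta> = norm (grad C K)"
  define U where "U = (- 1 / \<delta>) *\<^sub>R grad C K"
  define \<phi> where "\<phi> r = C (K + r *\<^sub>R U)" for r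
  \<comment> \<open>The length of the step, as U is a unit vector.\<close>
  let ?S = "\<eta> * \<delta>"
  have \<delta>: "0 < \<delta>" unfolding \<delta>_def using False by simp
  have U: "norm U = 1" unfolding U_def using \<delta> by (simp add: \<delta>_def)
  have Lp: "0 < L \<alpha>" by (rule L_pos[OF K C_le])
  have \<eta>L: "\<eta> * L \<alpha> \<le> 1" using \<eta> Lp by (simp add: field_simps)
  have slope0: "dP (K + 0 *\<^sub>R U) U \<bullet> X0 = - \<delta>"
  proof -
    have "dP (K + 0 *\<^sub>R U) U \<bullet> X0 = U \<bullet> grad C K"
      using cost_line_derivatives(3)[of K 0 U] K by simp
    also have "\<dots> = - \<delta>"
      unfolding U_def using \<delta> by (simp add: \<delta>_def dot_square_norm power2_eq_square)
    finally show ?thesis .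
  qed
  define good where "good s \<longleftrightarrow> (\<forall>r. 0 \<le> r \<longrightarrow> r \<le> s \<longrightarrow> K + r *\<^sub>R U \<in> \<K> \<and> \<phi> r \<le> \<phi> 0)" for s
  have phi0: "\<phi> 0 = C K" by (simp add: \<phi>_def)
  have taylor: "\<phi> s \<le> C K - s * \<delta> + L \<alpha> * s\<^sup>2 / 2" if s: "0 \<le> s" "good s" for s
  proof -
    have "\<phi> s \<le> \<phi> 0 + s * (dP (K + 0 *\<^sub>R U) U \<bullet> X0) + L \<alpha> * s\<^sup>2 / 2"
    proof (rule taylor_quadratic_upper_bound[OF s(1)])
      fix r assume r: "0 \<le> r" "r \<le> s"
      then have Kr: "K + r *\<^sub>R U \<in> \<K>" "C (K + r *\<^sub>R U) \<le> \<alpha>"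
        using s(2) C_le phi0 unfolding good_def \<phi>_def by auto
      show "(\<phi> has_real_derivative dP (K + r *\<^sub>R U) U \<bullet> X0) (at r)"
        unfolding \<phi>_def by (rule cost_line_derivatives(1)[OF Kr(1)])
      show "((\<lambda>r. dP (K + r *\<^sub>R U) U \<bullet> X0) has_real_derivative
          ddP_source (K + r *\<^sub>R U) U \<bullet> X (K + r *\<^sub>R U)) (at r)"
        by (rule cost_line_derivatives(2)[OF Kr(1)])
      show "ddP_source (K + r *\<^sub>R U) U \<bullet> X (K + r *\<^sub>R U) \<le> L \<alpha>"
        by (rule hessian_le[OF Kr U])
    qed
    then show ?thesis unfolding slope0 phi0 by simp
  qed
  have "good ?S"
  proof -
    define I where "I = {s. 0 \<le> s \<and> s \<le> ?S \<and> good s}"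
    have good0: "good 0" unfolding good_def using K by (auto dest: order_antisym)
    have S0: "0 \<le> ?S" using \<eta> \<delta> by simp
    have I0: "0 \<in> I" unfolding I_def using good0 S0 by simp
    have bdd: "bdd_above I" unfolding I_def by (rule bdd_aboveI[of _ ?S]) auto
    define s where "s = Sup I"
    have s: "0 \<le> s" "s \<le> ?S"
      unfolding s_def using I0 bdd by (auto intro!: cSup_upper cSup_least simp: I_def)
    have below: "K + r *\<^sub>R U \<in> \<K> \<and> \<phi> r \<le> \<phi> 0" if r: "0 \<le> r" "r < s" for r
    proof -
      obtain s' where "s' \<in> I" "r < s'" using r(2) I0 less_cSupD[of I r] unfolding s_def by blast
      then show ?thesis using r unfolding I_def good_def by auto
    qed
    \<comment> \<open>The radius \<open>d\<close> depends on the cost level only, so it serves every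
      earlier point of the segment; one of them lies within \<open>d\<close> of the point at
      s.\<close>
    have Ks: "K + s *\<^sub>R U \<in> \<K>"
    proof (cases "s = 0")
      case True then show ?thesis using K by simp
    next
      case False
      obtain d where d: "d > 0"
        "\<And>K1 K'. \<lbrakk>K1 \<in> \<K>; C K1 \<le> C K; norm (K' - K1) < d\<rbrakk> \<Longrightarrow> K' \<in> \<K>"
        using stab_gains_uniform_nbhd[OF cost_pos[OF K]] by blast
      define r where "r = max 0 (s - d / 2)"
      have r: "0 \<le> r" "r < s" "s - r < d" unfolding r_def using d(1) s(1) False by auto
      have "norm ((K + s *\<^sub>R U) - (K + r *\<^sub>R U)) = s - r"
        using U r by (simp add: scaleR_left_diff_distrib[symmetric])
      then show ?thesis using d(2)[of "K + r *\<^sub>R U" "K + s *\<^sub>R U"] below[OF r(1,2)] r(3) phi0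
        unfolding \<phi>_def by simp
    qed
    have cont: "isCont \<phi> s"
      unfolding \<phi>_def using DERIV_isCont[OF cost_line_derivatives(1)[OF Ks]] .
    have "\<phi> s \<le> \<phi> 0"
    proof (cases "s = 0")
      case False
      have "(\<phi> \<longlongrightarrow> \<phi> s) (at_left s)"
        using cont unfolding isCont_def by (rule filterlim_mono[OF _ order_refl at_le]) simp
      moreover have "eventually (\<lambda>r. \<phi> r \<le> \<phi> 0) (at_left s)"
        using eventually_at_left_real[of 0 s] False s(1)
        by (auto elim!: eventually_mono intro: below[THEN conjunct2])
      ultimately show ?thesis by (rule tendsto_upperbound) simp
    qed simp
    then have good_s: "good s" unfolding good_def using below Ks by (metis order_le_less)
    have "s = ?S"
    proof (rule ccontr)
      assume "s \<noteq> ?S"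
      then have sS: "s < ?S" using s(2) by simp
      \<comment> \<open>The cost has to stay below its initial value slightly beyond s. At s = 0
        there is no strict inequality to extend, and the negative slope is used instead; for 0 < s <
        S one has L s < \<delta>, so Taylor's bound is strict and continuity extends it.\<close>
      have "\<exists>d>0. \<forall>r. s < r \<longrightarrow> r < s + d \<longrightarrow> \<phi> r \<le> \<phi> 0"
      proof (cases "s = 0")
        case True
        have "(\<phi> has_real_derivative - \<delta>) (at 0)"
          using cost_line_derivatives(1)[of K 0 U] K slope0 unfolding \<phi>_def by simp
        from DERIV_neg_dec_right[OF this] \<delta> obtain d where d: "d > 0" "\<And>h. 0 < h \<Longrightarrow> h < d \<Longrightarrow> \<phi> (0 + h) < \<phi> 0"
          by auto
        then have "\<forall>r. s < r \<longrightarrow> r < s + d \<longrightarrow> \<phi> r \<le> \<phi> 0" using True by fastforce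
        then show ?thesis using d(1) by blast
      next
        case False
        have "L \<alpha> * s < \<delta>"
        proof -
          have "L \<alpha> * s < L \<alpha> * ?S" using sS Lp by simp
          also have "\<dots> \<le> \<delta>" using \<eta>L \<delta> by (simp add: mult.assoc[symmetric] mult.commute[of "L \<alpha>"] mult_left_le_one_le)
          finally show ?thesis .
        qed
        then have "s * (L \<alpha> * s) < s * \<delta>" using s(1) False by (intro mult_strict_left_mono) auto
        moreover have "0 \<le> s * (L \<alpha> * s)" using s(1) Lp by simp
        ultimately have "\<phi> s < \<phi> 0"
          using taylor[OF s(1) good_s] unfolding phi0 by (simp add: power2_eq_square mult_ac)
        then have "eventually (\<lambda>r. \<phi> r < \<phi> 0) (nhds s)"
          using cont unfolding isCont_def tendsto_at_iff_tendsto_nhds by (rule order_tendstoD(2)[rotated])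
        then obtain d where "d > 0" "\<And>r. dist r s < d \<Longrightarrow> \<phi> r < \<phi> 0"
          unfolding eventually_nhds_metric by blast
        then show ?thesis by (intro exI[of _ d]) (auto simp: dist_real_def intro!: less_imp_le)
      qed
      then obtain d1 where d1: "d1 > 0" "\<And>r. s < r \<Longrightarrow> r < s + d1 \<Longrightarrow> \<phi> r \<le> \<phi> 0" by blast
      obtain d2 where d2: "d2 > 0" "\<And>r. dist r s < d2 \<Longrightarrow> K + r *\<^sub>R U \<in> \<K>"
        using eventually_stab_line[OF Ks] unfolding eventually_nhds_metric by blast
      define e where "e = min (min (d1 / 2) (d2 / 2)) (?S - s)"
      have e: "0 < e" "e < d1" "e < d2" "s + e \<le> ?S" unfolding e_def using d1(1) d2(1) sS by auto
      have "good (s + e)"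
        unfolding good_def
      proof (intro allI impI)
        fix r assume r: "0 \<le> r" "r \<le> s + e"
        show "K + r *\<^sub>R U \<in> \<K> \<and> \<phi> r \<le> \<phi> 0"
        proof (cases "r \<le> s")
          case True then show ?thesis using good_s r(1) unfolding good_def by blast
        next
          case False
          then show ?thesis using r e d1(2)[of r] d2(2)[of r] by (auto simp: dist_real_def)
        qed
      qed
      then have "s + e \<in> I" unfolding I_def using s(1) e by simp
      then have "s + e \<le> s" unfolding s_def using bdd by (rule cSup_upper)
      then show False using e(1) by simp
    qed
    then show ?thesis using good_s by simp
  qed
  have step: "K + ?S *\<^sub>R U = K - \<eta> *\<^sub>R grad C K" unfolding U_def using \<delta> by simp
  have "\<phi> ?S \<le> C K - ?S * \<delta> + L \<alpha> * ?S\<^sup>2 / 2"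
    using taylor \<open>good ?S\<close> \<eta> \<delta> by simp
  also have "\<dots> = C K - \<eta> * \<delta>\<^sup>2 + (\<eta> * L \<alpha>) * (\<eta> * \<delta>\<^sup>2) / 2" by (simp add: power2_eq_square mult_ac)
  also have "\<dots> \<le> C K - \<eta> * \<delta>\<^sup>2 + 1 * (\<eta> * \<delta>\<^sup>2) / 2"
    using \<eta>L \<eta> by (intro add_left_mono divide_right_mono mult_right_mono) auto
  also have "\<dots> = C K - \<eta> / 2 * \<delta>\<^sup>2" by simp
  finally have "\<phi> ?S \<le> C K - \<eta> / 2 * \<delta>\<^sup>2" .
  moreover have "K + ?S *\<^sub>R U \<in> \<K>" using \<open>good ?S\<close> \<eta> \<delta> unfolding good_def by simp
  ultimately show ?thesis unfolding \<phi>_def step unfolding \<delta>_def by blast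
qed

lemma max_norm_X_pos:
  assumes "K \<in> \<K>"
  shows "0 < max_norm (X K)"
proof -
  have "\<mu> * (axis undefined 1 \<bullet> (axis undefined 1 :: real^'d))
      \<le> max_norm (X K) * (axis undefined 1 \<bullet> (axis undefined 1 :: real^'d))"
    using X_ge_mu[OF assms] form_le_max_norm order_trans by blast
  then show ?thesis using mu_pos by (simp add: inner_axis)
qed

lemma descent_rate:
  assumes K: "K \<in> \<K>" and C_le: "C K \<le> \<alpha>" and \<eta>: "0 < \<eta>" "\<eta> \<le> 1 / L \<alpha>" and K': "K' \<in> \<K>"
  shows "C (K - \<eta> *\<^sub>R grad C K) - C K'
    \<le> (1 - 2 * \<mu>\<^sup>2 * Lambda_min R / max_norm (X K') * \<eta>) * (C K - C K')"
proof -
  let ?x = "max_norm (X K')"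
  have "4 * \<mu>\<^sup>2 * Lambda_min R * (C K - C K') / ?x \<le> (norm (grad C K))\<^sup>2"
    using gradient_dominance[OF K K'] max_norm_X_pos[OF K'] by (simp add: divide_le_eq mult.commute)
  then have "\<eta> / 2 * (4 * \<mu>\<^sup>2 * Lambda_min R * (C K - C K') / ?x) \<le> \<eta> / 2 * (norm (grad C K))\<^sup>2"
    using \<eta>(1) by (intro mult_left_mono) auto
  moreover have "\<eta> / 2 * (4 * \<mu>\<^sup>2 * Lambda_min R * (C K - C K') / ?x)
      = 2 * \<mu>\<^sup>2 * Lambda_min R / ?x * \<eta> * (C K - C K')"
    by simp
  moreover have "C (K - \<eta> *\<^sub>R grad C K) \<le> C K - \<eta> / 2 * (norm (grad C K))\<^sup>2"
    using descent[OF K C_le \<eta>] by blast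
  ultimately show ?thesis unfolding left_diff_distrib mult_1 by linarith
qed

end

theorem theorem1:
  fixes A :: "(real^'d::finite^'d)^'s::finite"
    and B :: "(real^'k::finite^'d)^'s"
    and Q :: "(real^'d^'d)^'s"
    and R :: "(real^'k^'k)^'s"
    and p :: "'s \<Rightarrow> 's \<Rightarrow> real"
    and \<pi> :: "'s \<Rightarrow> real"
    and Sigma0 :: "real^'d^'d"
    and K0 Kstar :: "(real^'d^'k)^'s"
    and Kseq :: "nat \<Rightarrow> (real^'d^'k)^'s"
    and \<eta> :: real
  defines "C \<equiv> cost A B Q R p \<pi> Sigma0"
    and "\<K> \<equiv> stab_gains A B p"
    and "\<mu> \<equiv> Min (range \<pi>) * sigma_min Sigma0"
  assumes p_nonneg: "\<forall>i j. p i j \<ge> 0"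
    and p_stoch: "\<forall>i. (\<Sum>j\<in>UNIV. p i j) = 1"
    and pi_pos: "\<forall>i. \<pi> i > 0"
    and pi_sum: "(\<Sum>i\<in>UNIV. \<pi> i) = 1"
    and Sigma0_pd: "pos_def Sigma0"
    and Q_pd: "\<forall>i. pos_def (Q $ i)"
    and R_pd: "\<forall>i. pos_def (R $ i)"
    and stabilizable: "\<exists>K. K \<in> \<K>"
    and Kstar_opt: "Kstar \<in> \<K>" "\<forall>K\<in>\<K>. C Kstar \<le> C K"
    and K0_stab: "K0 \<in> \<K>"
    and step: "\<eta> > 0"
      "\<eta> \<le> 1 / (let \<alpha> = C K0;
                     \<xi> = (1 / Lambda_min Q) * ((1 + (max_norm B)\<^sup>2) / \<mu> * \<alpha> + max_norm R) - 1
                 in 2 * (max_norm R + (max_norm B)\<^sup>2 * (1 + 2 * \<xi> / max_norm B) * (\<alpha> / \<mu>))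
                      * (\<alpha> / Lambda_min Q))"
    and iter0: "Kseq 0 = K0"
    and iter: "\<forall>n. Kseq (Suc n) = Kseq n - \<eta> *\<^sub>R grad C (Kseq n)"
  shows "\<forall>n. Kseq n \<in> \<K> \<and>
           C (Kseq n) - C Kstar
             \<le> (1 - 2 * \<mu>\<^sup>2 * Lambda_min R / max_norm (XK A B p \<pi> Sigma0 Kstar) * \<eta>) ^ n
                * (C K0 - C Kstar)"
proof -
  interpret mjls A B Q R p \<pi> Sigma0
    using p_nonneg p_stoch pi_pos Sigma0_pd Q_pd R_pd by unfold_locales auto
  have \<mu>: "\<mu> = mjls.\<mu> \<pi> Sigma0" unfolding assms(3) by (simp add: \<mu>_def)
  have \<eta>: "\<eta> \<le> 1 / L (C K0)"
    using step(2) unfolding L_def \<xi>_def \<mu> Let_def .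
  \<comment> \<open>The cost bound is carried along because the step size is tied to the level of
    K0; it makes the same L valid at every iterate.\<close>
  have inv: "Kseq n \<in> \<K> \<and> C (Kseq n) \<le> C K0" for n
  proof (induction n)
    case (Suc n)
    have "C (Kseq (Suc n)) \<le> C (Kseq n) - \<eta> / 2 * (norm (grad C (Kseq n)))\<^sup>2" "Kseq (Suc n) \<in> \<K>"
      using descent[of "Kseq n" "C K0" \<eta>] Suc step(1) \<eta> iter unfolding C_def \<K>_def by auto
    moreover have "0 \<le> \<eta> / 2 * (norm (grad C (Kseq n)))\<^sup>2" using step(1) by simp
    ultimately show ?case using Suc by linarith
  qed (use K0_stab iter0 in simp)
  let ?q = "1 - 2 * \<mu>\<^sup>2 * Lambda_min R / max_norm (XK A B p \<pi> Sigma0 Kstar) * \<eta>"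
  have "C (Kseq n) - C Kstar \<le> ?q ^ n * (C (Kseq 0) - C Kstar)" for n
  proof (rule geometric_decay)
    show "0 \<le> C (Kseq n) - C Kstar" for n using inv Kstar_opt(2) by simp
    show "C (Kseq (Suc n)) - C Kstar \<le> ?q * (C (Kseq n) - C Kstar)" for n
      using descent_rate[of "Kseq n" "C K0" \<eta> Kstar] inv[of n] step(1) \<eta> iter Kstar_opt(1)
      unfolding C_def \<K>_def \<mu> by auto
  qed
  then show ?thesis using inv iter0 by simp
qed

end
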